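(* Let $M$ be a compact connected metric space and let $A:M\times M\to\mathbb{R}$ be a continuous function such that the associated real number $l$ (the asymptotic growth rate of the functions $A_n$) equals $0$. Let $c(x,y)=\liminf_{n\to\infty}A_n(x,y)$ and $D=\{(x,y)\in M\times M: A(x,y)+c(y,x)=0\}$. Let $X=M^{\mathbb{Z}}$ and let $\mathcal{M}_T(X)$ be the set of translation-invariant Borel probability measures on $X$. Then $$\min_{\nu\in\mathcal{M}_T(X)}\int_X A(x_0,x_1)\,d\nu(x)=0.$$ A measure $\nu\in\mathcal{M}_T(X)$ is minimizing if and only if its marginal $\eta=(\pi_0\times\pi_1)_\sharp\nu$ is concentrated on $D$, i.e. $\eta(D)=1$.
   Context: Set $A_1=A$ and, for $n\geq 2$, $A_n(x,y)=\min_{z_1,\ldots,z_{n-1}\in M}\big(A(x,z_1)+A(z_1,z_2)+\cdots+A(z_{n-1},y)\big)$. For any continuous $A$ on $M\times M$ the functions $A_n$ are equicontinuous and there are a (unique) real number $l$ and a positive constant $C$ such that $|A_n(x,y)-ln|\leq C$ for all $n\geq 1$ and all $x,y\in M$. When $l=0$ the function $c$ is finite and continuous on $M\times M$. $X=M^{\mathbb{Z}}$ is endowed with the product topology; a point of $X$ is written $x=(\ldots,x_{-1},x_0,x_1,\ldots)$. The translation $T:X\to X$ is defined by $(Tx)_i=x_{i+1}$ for all $i\in\mathbb{Z}$, and $\mathcal{M}_T(X)$ is the set of Borel probability measures $\nu$ on $X$ with $T_\sharp\nu=\nu$. The map $\pi_0\times\pi_1:X\to M\times M$ is $x\mapsto(x_0,x_1)$,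 and the subscript $\sharp$ denotes push-forward. *)

theory Defs
  imports "HOL-Probability.Probability"
begin

text \<open>The intermediate points of a chain from \<open>x\<close> to \<open>y\<close> are \<open>z 1, \<dots>, z (n - 1)\<close>; the values of \<open>z\<close> beyond
  \<open>n\<close> are irrelevant. The minimum is attained whenever \<open>A\<close> is continuous on a compact space,
  and only \<open>n \<ge> 1\<close> is meaningful.\<close>

definition chain_cost :: "('a \<times> 'a \<Rightarrow> real) \<Rightarrow> nat \<Rightarrow> 'a \<times> 'a \<Rightarrow> real" where
  "chain_cost A n = (\<lambda>(x, y).
     LEAST v. \<exists>z :: nat \<Rightarrow> 'a. z 0 = x \<and> z n = y \<and> v = (\<Sum>i<n. A (z i, z (Suc i))))"

lemma chain_cost_1: "chain_cost A 1 = A"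
proof
  fix p :: "'a \<times> 'a"
  obtain x y where p: "p = (x, y)" by fastforce
  have "(\<exists>z :: nat \<Rightarrow> 'a. z 0 = x \<and> z 1 = y \<and> v = (\<Sum>i<1. A (z i, z (Suc i)))) \<longleftrightarrow> v = A (x, y)" for v
    by (auto intro: exI[of _ "\<lambda>i. if i = 0 then x else y"])
  then show "chain_cost A 1 p = A p"
    by (simp add: chain_cost_def p Least_equality)
qed

text \<open>For continuous \<open>A\<close> on a compact space exactly one such \<open>l\<close> exists.\<close>

definition growth_rate :: "('a \<times> 'a \<Rightarrow> real) \<Rightarrow> real" where
  "growth_rate A =
     (THE l. \<exists>C>0. \<forall>n\<ge>1. \<forall>x y. \<bar>chain_cost A n (x, y) - l * real n\<bar> \<le> C)"

text \<open>The lower limit is taken in the extended reals; it is finite when the growth rate is \<open>0\<close>.\<close>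

definition liminf_cost :: "('a \<times> 'a \<Rightarrow> real) \<Rightarrow> 'a \<times> 'a \<Rightarrow> ereal" where
  "liminf_cost A p = liminf (\<lambda>n. ereal (chain_cost A n p))"

definition calibrated_set :: "('a \<times> 'a \<Rightarrow> real) \<Rightarrow> ('a \<times> 'a) set" where
  "calibrated_set A = {(x, y). ereal (A (x, y)) + liminf_cost A (y, x) = 0}"

definition translation :: "(int \<Rightarrow> 'a) \<Rightarrow> (int \<Rightarrow> 'a)" where
  "translation x = (\<lambda>i. x (i + 1))"

text \<open>Here \<open>borel\<close> is the Borel sigma-algebra of the product topology on \<open>int \<Rightarrow> 'a\<close>.\<close>

definition invariant_measures :: "(int \<Rightarrow> 'a::topological_space) measure set" where
  "invariant_measures =
     {\<nu>. sets \<nu> = sets borel \<and> prob_space \<nu> \<and> distr \<nu> borel translation = \<nu>}"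

definition mean_action :: "('a \<times> 'a \<Rightarrow> real) \<Rightarrow> (int \<Rightarrow> 'a) measure \<Rightarrow> real" where
  "mean_action A \<nu> = (\<integral>x. A (x 0, x 1) \<partial>\<nu>)"

definition minimizing :: "('a::topological_space \<times> 'a \<Rightarrow> real) \<Rightarrow> (int \<Rightarrow> 'a) measure \<Rightarrow> bool" where
  "minimizing A \<nu> \<longleftrightarrow> is_arg_min (mean_action A) (\<lambda>\<mu>. \<mu> \<in> invariant_measures) \<nu>"

definition marginal :: "(int \<Rightarrow> 'a::topological_space) measure \<Rightarrow> ('a \<times> 'a) measure" where
  "marginal \<nu> = distr \<nu> borel (\<lambda>x. (x 0, x 1))"

end

theory Submission
  imports Defs
begin

text \<open>The function \<open>u = c(p, \<cdot>)\<close> satisfies \<open>u(y) - u(x) \<le> A(x, y)\<close>, so invariance makes the action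
  of every invariant measure the integral of the nonnegative \<open>A(x\<^sub>0, x\<^sub>1) - u(x\<^sub>1) + u(x\<^sub>0)\<close>. Closed
  minimal chains of length \<open>n\<close> give periodic orbit measures of mean action \<open>O(1/n)\<close>, and a weak limit
  of them has action \<open>0\<close>. On \<open>D\<close> the triangle inequality for \<open>c\<close> forces the integrand to vanish.
  Conversely, if it vanishes almost everywhere, then the cost of a chain along a typical orbit
  telescopes to a difference of values of \<open>u\<close>, and by Poincare recurrence the orbit returns close to
  \<open>x\<^sub>0\<close>, which yields \<open>c(x\<^sub>1, x\<^sub>0) \<le> u(x\<^sub>0) - u(x\<^sub>1) = - A(x\<^sub>0, x\<^sub>1)\<close>.\<close>

section \<open>Minimal chains and the barrier\<close>

text \<open>Tychonoff's theorem in type class form. It is used for chains indexed by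
  \<open>nat\<close> and for bi-infinite sequences indexed by \<open>int\<close>.\<close>

lemma compact_UNIV_fun:
  assumes "compact (UNIV :: 'a::topological_space set)"
  shows "compact (UNIV :: ('i \<Rightarrow> 'a) set)"
proof -
  have "compact_space (euclidean :: 'a topology)"
    using assms by (simp add: compact_space_def)
  then have "compact_space (product_topology (\<lambda>i::'i. euclidean :: 'a topology) UNIV)"
    by (simp add: compact_space_product_topology)
  then show ?thesis
    by (simp add: euclidean_product_topology compact_space_def)
qed

lemma continuous_coordinate: "continuous_on S (\<lambda>x :: 'i \<Rightarrow> 'a::topological_space. x i)"
  by (rule continuous_on_product_then_coordinatewise) (rule continuous_on_id)

section \<open>Attainment, concatenation and equicontinuity of chain costs\<close>

locale compact_chains =
  fixes A :: "'a::metric_space \<times> 'a \<Rightarrow> real"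
  assumes compact_UNIV: "compact (UNIV :: 'a set)"
    and continuous_A: "continuous_on UNIV A"
begin

abbreviation action :: "(nat \<Rightarrow> 'a) \<Rightarrow> nat \<Rightarrow> real" where
  "action z n \<equiv> \<Sum>i<n. A (z i, z (Suc i))"

lemma continuous_action: "continuous_on S (\<lambda>z. action z n)"
  by (intro continuous_intros continuous_on_compose2[OF continuous_A] continuous_coordinate) auto

text \<open>The chains with prescribed endpoints form a closed subset of a compact product, and the
  action is continuous on it, so the \<open>LEAST\<close> in \<open>chain_cost\<close> is an
  attained minimum.\<close>

lemma chain_cost_Least:
  assumes "n \<ge> 1"
  shows "\<exists>z. z 0 = x \<and> z n = y \<and> chain_cost A n (x, y) = action z n"
    and "z 0 = x \<Longrightarrow> z n = y \<Longrightarrow> chain_cost A n (x, y) \<le> action z n"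
proof -
  let ?Z = "{z :: nat \<Rightarrow> 'a. z 0 = x \<and> z n = y}"
  have "closed ?Z"
    by (intro closed_Collect_conj closed_Collect_eq continuous_coordinate continuous_on_const)
  then have cpt: "compact ?Z"
    using closed_Int_compact[OF _ compact_UNIV_fun[OF compact_UNIV], of ?Z] by (simp only: Int_UNIV_right)
  \<comment> \<open>This chain jumps to \<open>y\<close> at once and stays there;
    \<open>n >= 1\<close> keeps its two endpoint conditions compatible.\<close>
  have "(\<lambda>i. if i = 0 then x else y) \<in> ?Z"
    using assms by auto
  then have ne: "?Z \<noteq> {}"
    by (rule ex_in_conv[THEN iffD1, OF exI])
  have "\<exists>z0\<in>?Z. \<forall>z\<in>?Z. action z0 n \<le> action z n"
    by (rule continuous_attains_inf[OF cpt ne continuous_action])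
  then obtain z0 where z0: "z0 \<in> ?Z" and min: "\<forall>z\<in>?Z. action z0 n \<le> action z n"
    by (rule bexE)
  have eq: "chain_cost A n (x, y) = action z0 n"
    unfolding chain_cost_def prod.case
  proof (rule Least_equality)
    show "\<exists>z. z 0 = x \<and> z n = y \<and> action z0 n = action z n"
      by (rule exI[of _ z0]) (use z0 in simp)
  next
    fix v assume "\<exists>z. z 0 = x \<and> z n = y \<and> v = action z n"
    then obtain z where "z \<in> ?Z" "v = action z n"
      by (elim exE conjE) simp
    then show "action z0 n \<le> v"
      using min by simp
  qed
  then show "\<exists>z. z 0 = x \<and> z n = y \<and> chain_cost A n (x, y) = action z n"
    by (intro exI[of _ z0]) (use z0 in simp)
  show "chain_cost A n (x, y) \<le> action z n" if "z 0 = x" "z n = y"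
    unfolding eq using that min by simp
qed

lemma chain_cost_le_action: "n \<ge> 1 \<Longrightarrow> chain_cost A n (z 0, z n) \<le> action z n"
  by (rule chain_cost_Least(2)) auto

lemma action_add: "action z (m + n) = action z m + action (\<lambda>i. z (m + i)) n"
  by (induction n) auto

text \<open>Two minimal chains are concatenated at their common point \<open>y\<close>.\<close>

lemma chain_cost_triangle:
  assumes "m \<ge> 1" "n \<ge> 1"
  shows "chain_cost A (m + n) (x, z) \<le> chain_cost A m (x, y) + chain_cost A n (y, z)"
proof -
  obtain u where u: "u 0 = x" "u m = y" "chain_cost A m (x, y) = action u m"
    using chain_cost_Least(1)[OF assms(1)] by blast
  obtain v where v: "v 0 = y" "v n = z" "chain_cost A n (y, z) = action v n"
    using chain_cost_Least(1)[OF assms(2)] by blast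
  define w where "w i = (if i \<le> m then u i else v (i - m))" for i
  have "action w m = action u m"
    by (rule sum.cong) (auto simp: w_def)
  moreover have shift: "w (m + i) = v i" for i
    by (cases i) (use u v in \<open>auto simp: w_def\<close>)
  ultimately have "action w (m + n) = chain_cost A m (x, y) + chain_cost A n (y, z)"
    unfolding action_add[of w m n] shift using u v by simp
  moreover have "w 0 = x" "w (m + n) = z"
    using u v shift[of n] by (auto simp: w_def)
  ultimately show ?thesis
    using chain_cost_le_action[of "m + n" w] assms by simp
qed

text \<open>A minimal chain is cut at its point of index \<open>m\<close>. Up to the oscillation of
  the costs, this gives the superadditivity needed for the growth rate.\<close>

lemma chain_cost_split:
  assumes "m \<ge> 1" "n \<ge> 1"
  shows "\<exists>y. chain_cost A m (x, y) + chain_cost A n (y, z) \<le> chain_cost A (m + n) (x, z)"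
proof -
  obtain w where w: "w 0 = x" "w (m + n) = z" "chain_cost A (m + n) (x, z) = action w (m + n)"
    using chain_cost_Least(1)[of "m + n"] assms by fastforce
  have "chain_cost A m (w 0, w m) \<le> action w m"
    by (rule chain_cost_le_action[OF assms(1)])
  moreover have "chain_cost A n (w (m + 0), w (m + n)) \<le> action (\<lambda>i. w (m + i)) n"
    using chain_cost_le_action[OF assms(2), of "\<lambda>i. w (m + i)"] by simp
  ultimately show ?thesis
    using w action_add[of w m n] by (intro exI[of _ "w m"]) auto
qed

text \<open>A chain of length at least \<open>2\<close> has distinct first and last edges, so its endpoints can be
  moved at the expense of these two edges only, uniformly in the length.\<close>

lemma chain_cost_move_endpoints:
  assumes "n \<ge> 2"
    and "\<And>z. A (x', z) \<le> A (x, z) + e" "\<And>z. A (z, y') \<le> A (z, y) + e"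
  shows "chain_cost A n (x', y') \<le> chain_cost A n (x, y) + 2 * e"
proof -
  obtain m where n: "n = Suc (Suc m)"
    using assms(1) by (metis One_nat_def Suc_1 Suc_le_D Suc_le_mono)
  \<comment> \<open>The first and last edges are peeled off; the middle sum involves only interior
    points.\<close>
  have expand: "action z n = A (z 0, z 1) + (\<Sum>i<m. A (z (Suc i), z (Suc (Suc i)))) + A (z (Suc m), z n)"
    for z
    unfolding n by (subst sum.lessThan_Suc, subst sum.lessThan_Suc_shift) simp
  obtain z where z: "z 0 = x" "z n = y" "chain_cost A n (x, y) = action z n"
    using chain_cost_Least(1)[of n] assms(1) by fastforce
  define w where "w = z(0 := x', n := y')"
  have "chain_cost A n (w 0, w n) \<le> action w n"
    using assms(1) by (intro chain_cost_le_action) auto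
  moreover have "w 0 = x'" "w n = y'" "\<And>i. i \<le> m \<Longrightarrow> w (Suc i) = z (Suc i)"
    by (auto simp: w_def n)
  moreover have "(\<Sum>i<m. A (w (Suc i), w (Suc (Suc i)))) = (\<Sum>i<m. A (z (Suc i), z (Suc (Suc i))))"
    by (rule sum.cong) (auto simp: w_def n)
  ultimately have "chain_cost A n (x', y') \<le>
      A (x', z 1) + (\<Sum>i<m. A (z (Suc i), z (Suc (Suc i)))) + A (z (Suc m), y')"
    using expand[of w] by (auto simp: n)
  also have "\<dots> \<le> action z n + 2 * e"
    using expand[of z] z assms(2)[of "z 1"] assms(3)[of "z (Suc m)"] by auto
  finally show ?thesis
    using z by simp
qed

text \<open>Uniform continuity of \<open>A\<close> on the compact square controls the two end edges.
  The modulus does not depend on the length, so it survives the lower limit.\<close>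

lemma chain_cost_equicontinuous:
  assumes "e > 0"
  shows "\<exists>d>0. \<forall>n\<ge>2. \<forall>p q. dist p q < d \<longrightarrow> \<bar>chain_cost A n p - chain_cost A n q\<bar> \<le> e"
proof -
  have "compact (UNIV :: ('a \<times> 'a) set)"
    using compact_Times[OF compact_UNIV compact_UNIV] by simp
  then have "uniformly_continuous_on UNIV A"
    by (rule compact_uniformly_continuous[OF continuous_A])
  then obtain d where "d > 0" and "\<And>p q. dist p q < d \<Longrightarrow> \<bar>A p - A q\<bar> < e / 2"
    using assms unfolding uniformly_continuous_on_def dist_real_def
    by (metis UNIV_I half_gt_zero)
  then have d: "\<And>p q. dist p q < d \<Longrightarrow> A p \<le> A q + e / 2"
    by (smt (verit))
  have *: "chain_cost A n (x', y') \<le> chain_cost A n (x, y) + 2 * (e / 2)"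
    if "n \<ge> 2" "dist (x, y) (x', y') < d" for n x y x' y'
  proof (rule chain_cost_move_endpoints[OF that(1)])
    have le: "dist x x' < d" "dist y y' < d"
      using that(2) dist_fst_le[of "(x, y)" "(x', y')"] dist_snd_le[of "(x, y)" "(x', y')"] by auto
    fix z
    show "A (x', z) \<le> A (x, z) + e / 2"
      using d[of "(x', z)" "(x, z)"] le by (simp add: dist_Pair_Pair dist_commute)
    show "A (z, y') \<le> A (z, y) + e / 2"
      using d[of "(z, y')" "(z, y)"] le by (simp add: dist_Pair_Pair dist_commute)
  qed
  have "\<bar>chain_cost A n p - chain_cost A n q\<bar> \<le> e" if "n \<ge> 2" "dist p q < d" for n p q
    using *[of n "fst p" "snd p" "fst q" "snd q"] *[of n "fst q" "snd q" "fst p" "snd p"] that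
    by (auto simp: dist_commute)
  with \<open>d > 0\<close> show ?thesis by blast
qed

lemma chain_cost_bounded_oscillation:
  obtains B where "B > 0" "\<And>n p q. n \<ge> 1 \<Longrightarrow> \<bar>chain_cost A n p - chain_cost A n q\<bar> \<le> B"
proof -
  have "compact (range A)"
    using compact_Times[OF compact_UNIV compact_UNIV] continuous_A
    by (intro compact_continuous_image) auto
  then obtain K where "K > 0" and K: "\<And>p. \<bar>A p\<bar> \<le> K"
    using compact_imp_bounded[of "range A"] by (auto simp: bounded_pos)
  \<comment> \<open>Replacing one edge costs at most \<open>2 * K\<close>, and moving both endpoints
    replaces two edges. For \<open>n = 1\<close> the two end edges coincide.\<close>
  have *: "chain_cost A n (x', y') \<le> chain_cost A n (x, y) + 4 * K" if "n \<ge> 1" for n x y x' y'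
  proof (cases "n = 1")
    case True
    then show ?thesis
      using K[of "(x', y')"] K[of "(x, y)"] by (simp only: chain_cost_1)
  next
    case False
    have "A p \<le> A q + 2 * K" for p q
      using K[of p] K[of q] by auto
    then have "chain_cost A n (x', y') \<le> chain_cost A n (x, y) + 2 * (2 * K)"
      using that False by (intro chain_cost_move_endpoints) auto
    then show ?thesis by simp
  qed
  have "\<bar>chain_cost A n p - chain_cost A n q\<bar> \<le> 4 * K" if "n \<ge> 1" for n p q
    using *[OF that, of "fst p" "snd p" "fst q" "snd q"]
      *[OF that, of "fst q" "snd q" "fst p" "snd p"] by auto
  with \<open>K > 0\<close> show thesis
    by (intro that[of "4 * K"]) auto
qed

end

section \<open>Existence and uniqueness of the growth rate\<close>

text \<open>Fekete's lemma applied to the subadditive \<open>a\<close> and the superadditive \<open>a - b\<close>.\<close>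

lemma almost_additive_linear:
  fixes a :: "nat \<Rightarrow> real"
  assumes sub: "\<And>m n. m \<ge> 1 \<Longrightarrow> n \<ge> 1 \<Longrightarrow> a (m + n) \<le> a m + a n"
    and super: "\<And>m n. m \<ge> 1 \<Longrightarrow> n \<ge> 1 \<Longrightarrow> a m + a n - b \<le> a (m + n)"
  shows "\<exists>l. \<forall>n\<ge>1. \<bar>a n - l * real n\<bar> \<le> b"
proof -
  have up: "a (Suc k * n) \<le> Suc k * a n" if "n \<ge> 1" for n k
  proof (induction k)
    case (Suc k)
    then show ?case
      using sub[of n "Suc k * n"] that by (auto simp: algebra_simps)
  qed simp
  have lo: "Suc k * (a n - b) \<le> a (Suc k * n) - b" if "n \<ge> 1" for n k
  proof (induction k)
    case (Suc k)
    then show ?case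
      using super[of n "Suc k * n"] that by (auto simp: algebra_simps)
  qed simp
  have "b \<ge> 0"
    using sub[of 1 1] super[of 1 1] by simp
  \<comment> \<open>Both quotients are compared with \<open>a (k * n)\<close>, so every lower
    quotient lies below every upper one and the supremum of the lower ones separates the two
    families.\<close>
  have le: "(a n - b) / n \<le> a k / k" if n: "n \<ge> 1" and k: "k \<ge> 1" for n k
  proof -
    have "k * (a n - b) \<le> a (k * n) - b"
      using lo[OF n, of "k - 1"] k by simp
    also have "\<dots> \<le> n * a k"
      using up[OF k, of "n - 1"] n \<open>b \<ge> 0\<close> by (simp add: mult.commute)
    finally show ?thesis
      using n k by (simp add: field_simps)
  qed
  define l where "l = (SUP n\<in>{1..}. (a n - b) / n)"
  have "bdd_above ((\<lambda>n. (a n - b) / real n) ` {1..})"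
    using le[of _ 1] by (intro bdd_aboveI[of _ "a 1 / 1"]) auto
  then have "(a n - b) / n \<le> l" if "n \<ge> 1" for n
    unfolding l_def using that by (intro cSUP_upper) auto
  moreover have "l \<le> a n / n" if "n \<ge> 1" for n
    unfolding l_def using le that by (intro cSUP_least) auto
  ultimately have "\<bar>a n - l * real n\<bar> \<le> b" if "n \<ge> 1" for n
  proof -
    have "a n - b \<le> l * n" "l * n \<le> a n"
      using that \<open>\<And>n. n \<ge> 1 \<Longrightarrow> (a n - b) / n \<le> l\<close>[OF that] \<open>\<And>n. n \<ge> 1 \<Longrightarrow> l \<le> a n / n\<close>[OF that]
      by (auto simp: field_simps)
    then show ?thesis by simp
  qed
  then show ?thesis by blast
qed

lemma linear_rate_unique:
  fixes a :: "nat \<Rightarrow> real"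
  assumes "\<And>n. n \<ge> 1 \<Longrightarrow> \<bar>a n - l * real n\<bar> \<le> C" "\<And>n. n \<ge> 1 \<Longrightarrow> \<bar>a n - l' * real n\<bar> \<le> C'"
  shows "l = l'"
proof (rule ccontr)
  assume "l \<noteq> l'"
  then obtain n :: nat where n: "C + C' < real n * \<bar>l - l'\<bar>"
    using reals_Archimedean3[of "\<bar>l - l'\<bar>"] by auto
  have "real (Suc n) * \<bar>l - l'\<bar> = \<bar>real (Suc n) * (l - l')\<bar>"
    by (simp only: abs_mult abs_of_nat)
  also have "\<dots> = \<bar>(a (Suc n) - l' * Suc n) - (a (Suc n) - l * Suc n)\<bar>"
    by (simp add: algebra_simps)
  also have "\<dots> \<le> C + C'"
    using assms(1)[of "Suc n"] assms(2)[of "Suc n"] by linarith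
  finally show False
    using n abs_ge_zero[of "l - l'"] by (simp add: algebra_simps)
qed

context compact_chains
begin

text \<open>The costs from a base point to itself are almost additive, which yields a rate there;
  bounded oscillation carries it to all pairs. Uniqueness then justifies the \<open>THE\<close> in
  \<open>growth_rate\<close>.\<close>

lemma growth_rate_bound:
  "\<exists>C>0. \<forall>n\<ge>1. \<forall>x y. \<bar>chain_cost A n (x, y) - growth_rate A * real n\<bar> \<le> C"
proof -
  obtain B where "B > 0" and B: "\<And>n p q. n \<ge> 1 \<Longrightarrow> \<bar>chain_cost A n p - chain_cost A n q\<bar> \<le> B"
    using chain_cost_bounded_oscillation by blast
  fix o' :: 'a
  \<comment> \<open>The defect is \<open>2 * B\<close> because the cut point is moved to
    \<open>o'\<close> in both halves of a split chain, at cost at most \<open>B\<close>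
    each.\<close>
  have "\<exists>l. \<forall>n\<ge>1. \<bar>chain_cost A n (o', o') - l * real n\<bar> \<le> 2 * B"
  proof (rule almost_additive_linear)
    fix m n :: nat assume mn: "m \<ge> 1" "n \<ge> 1"
    show "chain_cost A (m + n) (o', o') \<le> chain_cost A m (o', o') + chain_cost A n (o', o')"
      using mn by (rule chain_cost_triangle)
    obtain y where "chain_cost A m (o', y) + chain_cost A n (y, o') \<le> chain_cost A (m + n) (o', o')"
      using chain_cost_split[OF mn] by blast
    then show "chain_cost A m (o', o') + chain_cost A n (o', o') - 2 * B \<le> chain_cost A (m + n) (o', o')"
      using B[OF mn(1), of "(o', y)" "(o', o')"] B[OF mn(2), of "(y, o')" "(o', o')"] by linarith
  qed
  then obtain l where l: "\<And>n. n \<ge> 1 \<Longrightarrow> \<bar>chain_cost A n (o', o') - l * real n\<bar> \<le> 2 * B"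
    by blast
  have "\<exists>C>0. \<forall>n\<ge>1. \<forall>x y. \<bar>chain_cost A n (x, y) - l * real n\<bar> \<le> C"
  proof (intro exI[of _ "3 * B"] conjI allI impI)
    fix n :: nat and x y assume "n \<ge> 1"
    then show "\<bar>chain_cost A n (x, y) - l * real n\<bar> \<le> 3 * B"
      using l[of n] B[of n "(x, y)" "(o', o')"] by linarith
  qed (use \<open>B > 0\<close> in simp)
  moreover have "l' = l" if "\<exists>C>0. \<forall>n\<ge>1. \<forall>x y. \<bar>chain_cost A n (x, y) - l' * real n\<bar> \<le> C" for l'
  proof -
    obtain C where "\<And>n. n \<ge> 1 \<Longrightarrow> \<bar>chain_cost A n (o', o') - l' * real n\<bar> \<le> C"
      using \<open>\<exists>C>0. \<forall>n\<ge>1. \<forall>x y. \<bar>chain_cost A n (x, y) - l' * real n\<bar> \<le> C\<close> by blast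
    from linear_rate_unique[of "\<lambda>n. chain_cost A n (o', o')", OF this l] show ?thesis .
  qed
  ultimately show ?thesis
    unfolding growth_rate_def by (rule theI[where a = l])
qed

end

section \<open>Cycles and the barrier at growth rate zero\<close>

locale critical_chains = compact_chains +
  assumes growth_rate_0: "growth_rate A = 0"
begin

lemma chain_cost_bounded:
  obtains C where "C > 0" "\<And>n p. n \<ge> 1 \<Longrightarrow> \<bar>chain_cost A n p\<bar> \<le> C"
  using growth_rate_bound by (auto simp: growth_rate_0)

text \<open>Repeating a cycle of negative cost would drive the costs to minus infinity, against the
  uniform bound available at growth rate zero.\<close>

lemma chain_cost_cycle_nonneg:
  assumes "n \<ge> 1"
  shows "0 \<le> chain_cost A n (x, x)"
proof (rule ccontr)
  assume neg: "\<not> 0 \<le> chain_cost A n (x, x)"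
  obtain C where C: "\<And>n p. n \<ge> 1 \<Longrightarrow> \<bar>chain_cost A n p\<bar> \<le> C"
    using chain_cost_bounded by blast
  have "chain_cost A (Suc k * n) (x, x) \<le> Suc k * chain_cost A n (x, x)" for k
  proof (induction k)
    case (Suc k)
    have "chain_cost A (Suc (Suc k) * n) (x, x) \<le> chain_cost A n (x, x) + chain_cost A (Suc k * n) (x, x)"
      using chain_cost_triangle[of n "Suc k * n"] assms by simp
    with Suc show ?case
      by (simp add: algebra_simps)
  qed simp
  then have *: "- C \<le> Suc k * chain_cost A n (x, x)" for k
  proof -
    have "Suc k * n \<ge> 1"
      using assms by simp
    from C[OF this, of "(x, x)"] \<open>\<And>k. chain_cost A (Suc k * n) (x, x) \<le> Suc k * chain_cost A n (x, x)\<close>[of k]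
    show ?thesis by linarith
  qed
  obtain k :: nat where "C < real k * - chain_cost A n (x, x)"
    using reals_Archimedean3[of "- chain_cost A n (x, x)"] neg by auto
  with *[of k] neg show False
    by (simp add: algebra_simps)
qed

text \<open>The function \<open>c\<close> as a real-valued function. \<open>real_of_ereal\<close>
  would send infinite values to 0, but \<open>liminf_cost_eq_barrier\<close> shows that none
  occur.\<close>

definition barrier :: "'a \<times> 'a \<Rightarrow> real" where
  "barrier p = real_of_ereal (liminf_cost A p)"

lemma liminf_cost_eq_barrier: "liminf_cost A p = ereal (barrier p)"
proof -
  obtain C where C: "\<And>n p. n \<ge> 1 \<Longrightarrow> \<bar>chain_cost A n p\<bar> \<le> C"
    using chain_cost_bounded by blast
  have ev: "\<forall>\<^sub>F n in sequentially. - C \<le> chain_cost A n p \<and> chain_cost A n p \<le> C"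
    by (rule eventually_sequentiallyI[of 1]) (use C in \<open>auto simp: abs_le_iff minus_le_iff\<close>)
  have "ereal (- C) \<le> liminf_cost A p"
    unfolding liminf_cost_def using ev by (intro Liminf_bounded) (auto elim: eventually_mono)
  moreover have "liminf_cost A p \<le> ereal C"
    unfolding liminf_cost_def using ev by (intro Liminf_le) (auto elim: eventually_mono)
  ultimately show ?thesis
    unfolding barrier_def by (cases "liminf_cost A p") auto
qed

text \<open>This and the next three lemmas translate the lower limit into eventual lower bounds and
  frequent upper bounds on chain costs, the form in which chains are estimated below.\<close>

lemma barrier_ge:
  assumes "\<forall>\<^sub>F n in sequentially. a \<le> chain_cost A n p"
  shows "a \<le> barrier p"
proof -
  have "ereal a \<le> liminf_cost A p"
    unfolding liminf_cost_def by (rule Liminf_bounded) (use assms in simp)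
  then show ?thesis
    by (simp add: liminf_cost_eq_barrier)
qed

lemma barrier_less_imp_eventually:
  assumes "a < barrier p"
  shows "\<forall>\<^sub>F n in sequentially. a < chain_cost A n p"
  using less_LiminfD[of "ereal a" sequentially "\<lambda>n. ereal (chain_cost A n p)"]
    assms liminf_cost_eq_barrier[of p] by (simp add: liminf_cost_def)

lemma barrier_le:
  assumes "\<exists>\<^sub>F n in sequentially. chain_cost A n p \<le> a"
  shows "barrier p \<le> a"
proof (rule ccontr)
  assume "\<not> barrier p \<le> a"
  then have "\<forall>\<^sub>F n in sequentially. a < chain_cost A n p"
    by (intro barrier_less_imp_eventually) simp
  with assms show False
    by (simp add: frequently_def not_le)
qed

lemma frequently_less_barrier:
  assumes "barrier p < a"
  shows "\<exists>\<^sub>F n in sequentially. chain_cost A n p < a"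
  using barrier_ge[of a p] assms unfolding frequently_def not_less by linarith

text \<open>A minimal chain of fixed length \<open>k\<close> is appended to arbitrarily long chains
  that nearly realize \<open>barrier (x, y)\<close>.\<close>

lemma barrier_step:
  assumes "k \<ge> 1"
  shows "barrier (x, z) \<le> barrier (x, y) + chain_cost A k (y, z)"
proof (rule field_le_epsilon)
  fix e :: real assume "e > 0"
  then have freq: "\<exists>\<^sub>F n in sequentially. chain_cost A n (x, y) < barrier (x, y) + e"
    by (intro frequently_less_barrier) simp
  show "barrier (x, z) \<le> barrier (x, y) + chain_cost A k (y, z) + e"
  proof (rule barrier_le, unfold frequently_sequentially, intro allI)
    fix N
    \<comment> \<open>\<open>Suc N\<close> rather than \<open>N\<close> ensures
      \<open>n >= 1\<close>, as concatenation requires.\<close>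
    obtain n where n: "n \<ge> Suc N" "chain_cost A n (x, y) < barrier (x, y) + e"
      using freq unfolding frequently_sequentially by blast
    then have "chain_cost A (n + k) (x, z) \<le> barrier (x, y) + chain_cost A k (y, z) + e"
      using chain_cost_triangle[of n k x z y] assms by simp
    then show "\<exists>n\<ge>N. chain_cost A n (x, z) \<le> barrier (x, y) + chain_cost A k (y, z) + e"
      using n by (intro exI[of _ "n + k"]) simp
  qed
qed

lemma barrier_triangle: "barrier (x, z) \<le> barrier (x, y) + barrier (y, z)"
proof -
  have "\<forall>\<^sub>F k in sequentially. barrier (x, z) - barrier (x, y) \<le> chain_cost A k (y, z)"
    by (rule eventually_sequentiallyI[of 1]) (simp add: barrier_step algebra_simps)
  from barrier_ge[OF this] show ?thesis by simp
qed

text \<open>The case \<open>k = 1\<close> of \<open>barrier_step\<close>. It makes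
  \<open>barrier (x, _)\<close> a subsolution: along an edge it grows by at most the cost of the
  edge.\<close>

lemma barrier_edge: "barrier (x, z) \<le> barrier (x, y) + A (y, z)"
  using barrier_step[of 1 x z y] by (simp only: chain_cost_1)

text \<open>The edge from \<open>x\<close> to \<open>y\<close> followed by any chain from
  \<open>y\<close> back to \<open>x\<close> is a cycle, hence has nonnegative cost.\<close>

lemma calibrated_nonneg: "0 \<le> A (x, y) + barrier (y, x)"
proof -
  have "- A (x, y) \<le> chain_cost A n (y, x)" if n: "n \<ge> 1" for n
  proof -
    have "0 \<le> chain_cost A (1 + n) (x, x)"
      by (rule chain_cost_cycle_nonneg) simp
    also have "\<dots> \<le> A (x, y) + chain_cost A n (y, x)"
      using chain_cost_triangle[OF order_refl n, of x x y] unfolding chain_cost_1 .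
    finally show ?thesis by simp
  qed
  then have "- A (x, y) \<le> barrier (y, x)"
    by (intro barrier_ge eventually_sequentiallyI[of 1])
  then show ?thesis by simp
qed

lemma calibrated_set_eq: "calibrated_set A = {(x, y). A (x, y) + barrier (y, x) = 0}"
  by (simp add: calibrated_set_def liminf_cost_eq_barrier zero_ereal_def)

lemma continuous_barrier: "continuous_on UNIV barrier"
  unfolding continuous_on_iff
proof (intro ballI allI impI)
  fix p :: "'a \<times> 'a" and e :: real assume "e > 0"
  then obtain d where "d > 0"
    and d: "\<And>n p q. n \<ge> 2 \<Longrightarrow> dist p q < d \<Longrightarrow> \<bar>chain_cost A n p - chain_cost A n q\<bar> \<le> e / 3"
    using chain_cost_equicontinuous[of "e / 3"] by auto
  \<comment> \<open>One third of \<open>e\<close> is lost to the lower limit and one third to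
    equicontinuity, leaving room for the strict inequality.\<close>
  have *: "barrier p \<le> barrier q + 2 * e / 3" if "dist p q < d" for p q
  proof -
    have "\<forall>\<^sub>F n in sequentially. barrier p - e / 3 < chain_cost A n p"
      using \<open>e > 0\<close> by (intro barrier_less_imp_eventually) simp
    moreover have "\<forall>\<^sub>F n in sequentially. chain_cost A n p \<le> chain_cost A n q + e / 3"
    proof (rule eventually_sequentiallyI)
      fix n :: nat assume "n \<ge> 2"
      from d[OF this that] show "chain_cost A n p \<le> chain_cost A n q + e / 3"
        by linarith
    qed
    ultimately have "\<forall>\<^sub>F n in sequentially. barrier p - 2 * e / 3 \<le> chain_cost A n q"
      by eventually_elim (simp add: field_simps)
    from barrier_ge[OF this] show ?thesis by simp
  qed
  have "dist (barrier q) (barrier p) < e" if "dist q p < d" for q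
    using *[of p q] *[of q p] that \<open>e > 0\<close> by (auto simp: dist_real_def abs_less_iff dist_commute)
  with \<open>d > 0\<close> show "\<exists>d>0. \<forall>q\<in>UNIV. dist q p < d \<longrightarrow> dist (barrier q) (barrier p) < e"
    by blast
qed

lemma closed_calibrated_set: "closed (calibrated_set A)"
proof -
  have "calibrated_set A = {p. A p + barrier (snd p, fst p) = 0}"
    by (auto simp: calibrated_set_eq)
  moreover have "closed \<dots>"
    by (intro closed_Collect_eq continuous_intros continuous_A
        continuous_on_compose2[OF continuous_barrier]) auto
  ultimately show ?thesis by simp
qed

end

section \<open>Weak compactness of probability measures on a compact metric space\<close>

text \<open>Total boundedness gives a finite cover by balls of radius \<open>1 / Suc n\<close> for
  each \<open>n\<close>. All these balls are enumerated in one sequence, so each scale needs only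
  finitely many indices. The sequence serves both the real coding and recurrence.\<close>

lemma compact_UNIV_separating_sequence:
  assumes "compact (UNIV :: 'b::metric_space set)"
  shows "\<exists>B :: nat \<Rightarrow> 'b set. (\<forall>j. open (B j)) \<and>
    (\<forall>e>0. \<exists>J. \<forall>x. \<exists>j<J. x \<in> B j \<and> (\<forall>y\<in>B j. dist x y < e))"
proof -
  have "\<exists>k. finite k \<and> (UNIV :: 'b set) \<subseteq> (\<Union>x\<in>k. ball x (1 / Suc n))" for n
    using assms unfolding compact_eq_totally_bounded by simp
  then obtain k where fin: "\<And>n. finite (k n)"
    and cover: "\<And>n. (UNIV :: 'b set) \<subseteq> (\<Union>x\<in>k n. ball x (1 / Suc n))"
    by metis
  define U where "U n = (\<lambda>x. ball x (1 / Suc n)) ` k n" for n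
  have finU: "finite (U n)" for n
    unfolding U_def using fin by simp
  have cnt: "countable (\<Union>n. U n)"
    by (rule countable_UN) (simp_all add: countable_finite finU)
  have ne: "(\<Union>n. U n) \<noteq> {}"
    using cover[of 0] unfolding U_def by fastforce
  define B where "B = from_nat_into (\<Union>n. U n)"
  show ?thesis
  proof (intro exI[of _ B] conjI allI impI)
    fix j
    have "B j \<in> (\<Union>n. U n)"
      unfolding B_def using ne by (rule from_nat_into)
    then show "open (B j)"
      by (auto simp: U_def)
  next
    fix e :: real assume "e > 0"
    then obtain n where n: "1 / Suc n < e / 2"
      using reals_Archimedean[of "e / 2"] by (auto simp: inverse_eq_divide)
    \<comment> \<open>This bound exceeds one index of each ball in the \<open>n\<close>-th
      cover.\<close>
    define J where "J = Suc (Max (to_nat_on (\<Union>n. U n) ` U n))"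
    show "\<exists>J. \<forall>x. \<exists>j<J. x \<in> B j \<and> (\<forall>y\<in>B j. dist x y < e)"
    proof (rule exI[of _ J], rule allI)
      fix x
      obtain c where c: "c \<in> k n" "x \<in> ball c (1 / Suc n)"
        using cover[of n] by blast
      define V where "V = ball c (1 / Suc n)"
      have "V \<in> U n"
        using c by (auto simp: V_def U_def)
      then have "B (to_nat_on (\<Union>n. U n) V) = V"
        unfolding B_def using cnt by (intro from_nat_into_to_nat_on) auto
      moreover have "to_nat_on (\<Union>n. U n) V < J"
        unfolding J_def less_Suc_eq_le using finU \<open>V \<in> U n\<close> by (intro Max_ge) auto
      moreover have "dist x y < e" if "y \<in> V" for y
        using that c(2) n dist_triangle_less_add[of x c "1 / Suc n" y "1 / Suc n"]
        by (simp add: V_def dist_commute)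
      ultimately show "\<exists>j<J. x \<in> B j \<and> (\<forall>y\<in>B j. dist x y < e)"
        using c(2) by (intro exI[of _ "to_nat_on (\<Union>n. U n) V"]) (auto simp: V_def)
    qed
  qed
qed

text \<open>The Cantor set coding: only the digits 0 and 2 occur, and the resulting gaps allow
  leading digits to be read off from an approximate value.\<close>

definition ternary :: "(nat \<Rightarrow> bool) \<Rightarrow> real" where
  "ternary d = (\<Sum>k. 2 * of_bool (d k) / 3 ^ Suc k)"

lemma summable_ternary: "summable (\<lambda>k. 2 * of_bool (d k) / 3 ^ Suc k :: real)"
proof (rule summable_comparison_test')
  show "summable (\<lambda>k. (2 / 3) * (1 / 3 :: real) ^ k)"
    by (intro summable_mult summable_geometric) simp
  show "norm (2 * of_bool (d k) / 3 ^ Suc k :: real) \<le> (2 / 3) * (1 / 3) ^ k" for k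
    by (auto simp: power_divide)
qed

lemma ternary_nonneg: "0 \<le> ternary d"
  unfolding ternary_def by (rule suminf_nonneg[OF summable_ternary]) simp

lemma ternary_le_1: "ternary d \<le> 1"
proof -
  have *: "(\<lambda>k. (2 / 3) * (1 / 3 :: real) ^ k) sums ((2 / 3) * (1 / (1 - 1 / 3)))"
    by (intro sums_mult geometric_sums) simp
  have "ternary d \<le> (\<Sum>k. (2 / 3) * (1 / 3 :: real) ^ k)"
    unfolding ternary_def
    by (rule suminf_le[OF _ summable_ternary sums_summable[OF *]]) (auto simp: power_divide)
  also have "\<dots> = 1"
    using sums_unique[OF *] by simp
  finally show ?thesis .
qed

lemma ternary_Suc: "ternary d = 2 / 3 * of_bool (d 0) + ternary (\<lambda>k. d (Suc k)) / 3"
proof -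
  have "ternary d = 2 * of_bool (d 0) / 3 ^ Suc 0 + (\<Sum>k. 2 * of_bool (d (Suc k)) / 3 ^ Suc (Suc k))"
    unfolding ternary_def using suminf_split_head[OF summable_ternary[of d]] by simp
  also have "(\<Sum>k. 2 * of_bool (d (Suc k)) / 3 ^ Suc (Suc k) :: real)
      = (\<Sum>k. (2 * of_bool (d (Suc k)) / 3 ^ Suc k) / 3)"
    by simp
  also have "\<dots> = ternary (\<lambda>k. d (Suc k)) / 3"
    unfolding ternary_def by (rule suminf_divide[OF summable_ternary])
  finally show ?thesis by simp
qed

text \<open>Different first digits force a distance of at least 1/3, since the tails contribute at
  most 1/3. If the first digits agree, removing them multiplies the distance by 3.\<close>

lemma ternary_close_imp_digits_eq:
  "\<bar>ternary d - ternary d'\<bar> < 1 / 3 ^ J \<Longrightarrow> j < J \<Longrightarrow> d j = d' j"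
proof (induction J arbitrary: d d' j)
  case (Suc J)
  let ?s = "\<lambda>d k. d (Suc k) :: bool"
  have "(1::real) / 3 ^ Suc J \<le> 1 / 3"
    by (simp add: field_simps)
  then have close: "\<bar>ternary d - ternary d'\<bar> < 1 / 3"
    using Suc.prems(1) by linarith
  have d0: "d 0 = d' 0"
    using close ternary_nonneg[of "?s d"] ternary_le_1[of "?s d"]
      ternary_nonneg[of "?s d'"] ternary_le_1[of "?s d'"]
    by (cases "d 0"; cases "d' 0") (auto simp: ternary_Suc[of d] ternary_Suc[of d'])
  have eq: "\<bar>ternary (?s d) - ternary (?s d')\<bar> = 3 * \<bar>ternary d - ternary d'\<bar>"
    unfolding ternary_Suc[of d] ternary_Suc[of d'] d0 by (simp flip: diff_divide_distrib)
  have "\<bar>ternary (?s d) - ternary (?s d')\<bar> < 1 / 3 ^ J"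
    unfolding eq using Suc.prems(1) by (simp add: field_simps)
  then have "?s d i = ?s d' i" if "i < J" for i
    using that by (rule Suc.IH)
  then show ?case
    using d0 Suc.prems(2) by (cases j) auto
qed simp

text \<open>The digits of \<open>h x\<close> record which sets \<open>B j\<close> contain
  \<open>x\<close>. Close codes agree on the first \<open>J\<close> memberships, so the two points
  share a small set. The code itself is only Borel, but its inverse is uniformly continuous.\<close>

lemma compact_UNIV_real_coding:
  assumes "compact (UNIV :: 'b::metric_space set)"
  shows "\<exists>h :: 'b \<Rightarrow> real. h \<in> borel_measurable borel \<and> (\<forall>x. 0 \<le> h x) \<and> (\<forall>x. h x \<le> 1) \<and>
    (\<forall>e>0. \<exists>d>0. \<forall>x y. dist (h x) (h y) < d \<longrightarrow> dist x y < e)"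
proof -
  obtain B :: "nat \<Rightarrow> 'b set" where opn: "\<forall>j. open (B j)"
    and B: "\<forall>e>0. \<exists>J. \<forall>x. \<exists>j<J. x \<in> B j \<and> (\<forall>y\<in>B j. dist x y < e)"
    using compact_UNIV_separating_sequence[OF assms] by (elim exE conjE) (rule that)
  define h where "h x = ternary (\<lambda>j. x \<in> B j)" for x
  show ?thesis
  proof (intro exI[of _ h] conjI allI impI)
    have [measurable]: "B j \<in> sets borel" for j
      using opn by simp
    show "h \<in> borel_measurable borel"
      unfolding h_def ternary_def of_bool_def by measurable
    show "0 \<le> h x" "h x \<le> 1" for x
      by (auto simp: h_def ternary_nonneg ternary_le_1)
    fix e :: real assume "e > 0"
    obtain J where J: "\<forall>x. \<exists>j<J. x \<in> B j \<and> (\<forall>y\<in>B j. dist x y < e)"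
      using B[rule_format, OF \<open>e > 0\<close>] by (rule exE)
    have "dist x y < e" if "\<bar>h x - h y\<bar> < 1 / 3 ^ J" for x y
    proof -
      have "(x \<in> B j) = (y \<in> B j)" if "j < J" for j
        using ternary_close_imp_digits_eq[OF \<open>\<bar>h x - h y\<bar> < 1 / 3 ^ J\<close>[unfolded h_def] that] .
      then show ?thesis
        using J[rule_format, of x] by blast
    qed
    then show "\<exists>d>0. \<forall>x y. dist (h x) (h y) < d \<longrightarrow> dist x y < e"
      by (intro exI[of _ "1 / 3 ^ J"]) (auto simp: dist_real_def)
  qed
qed

lemma uniformly_continuous_inverse_extends:
  fixes h :: "'b::metric_space \<Rightarrow> 'c::metric_space"
  assumes cpt: "compact (UNIV :: 'b set)"
    and inv: "\<forall>e>0. \<exists>d>0. \<forall>x y. dist (h x) (h y) < d \<longrightarrow> dist x y < e"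
  shows "\<exists>\<phi>. continuous_on (closure (range h)) \<phi> \<and> (\<forall>x. \<phi> (h x) = x)"
proof -
  \<comment> \<open>\<open>P\<close> is the graph of the extension: compactness provides a value at
    each point of the closure, and the modulus gives uniqueness and continuity together.\<close>
  define P where "P t y \<longleftrightarrow> (\<exists>s. (\<lambda>n. h (s n)) \<longlonglongrightarrow> t \<and> s \<longlonglongrightarrow> y)" for t y
  have ex: "\<exists>y. P t y" if t: "t \<in> closure (range h)" for t
  proof -
    obtain w where w: "\<forall>n. w n \<in> range h" "w \<longlonglongrightarrow> t"
      using t unfolding closure_sequential by (elim exE conjE) (rule that)
    define s where "s n = inv h (w n)" for n
    have "h (s n) = w n" for n
      unfolding s_def using w(1) by (simp add: f_inv_into_f)
    with w(2) have s: "(\<lambda>n. h (s n)) \<longlonglongrightarrow> t"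
      by simp
    obtain y r where r: "strict_mono (r :: nat \<Rightarrow> nat)" "(s \<circ> r) \<longlonglongrightarrow> y"
      using cpt[unfolded compact_def, rule_format, of s, OF UNIV_I] by (elim bexE exE conjE) (rule that)
    moreover have "(\<lambda>n. h ((s \<circ> r) n)) \<longlonglongrightarrow> t"
      using LIMSEQ_subseq_LIMSEQ[OF s r(1)] by (simp add: o_def)
    ultimately show ?thesis
      unfolding P_def by (intro exI[of _ y] exI[of _ "s \<circ> r"] conjI)
  qed
  have modulus: "\<exists>d>0. \<forall>t t' y y'. P t y \<and> P t' y' \<and> dist t t' < d \<longrightarrow> dist y y' \<le> e"
    if e: "e > 0" for e
  proof -
    obtain d where "d > 0" and d: "\<forall>x y. dist (h x) (h y) < d \<longrightarrow> dist x y < e"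
      using inv[rule_format, OF e] by (elim exE conjE) (rule that)
    show ?thesis
    proof (intro exI[of _ d] conjI allI impI \<open>d > 0\<close>, elim conjE)
      fix t t' y y'
      assume P: "P t y" "P t' y'" and lt: "dist t t' < d"
      obtain s where s: "(\<lambda>n. h (s n)) \<longlonglongrightarrow> t" "s \<longlonglongrightarrow> y"
        using P(1) unfolding P_def by (elim exE conjE) (rule that)
      obtain s' where s': "(\<lambda>n. h (s' n)) \<longlonglongrightarrow> t'" "s' \<longlonglongrightarrow> y'"
        using P(2) unfolding P_def by (elim exE conjE) (rule that)
      have "\<forall>\<^sub>F n in sequentially. dist (h (s n)) (h (s' n)) < d"
        by (rule order_tendstoD(2)[OF tendsto_dist[OF s(1) s'(1)] lt])
      then have "\<forall>\<^sub>F n in sequentially. dist (s n) (s' n) \<le> e"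
        by (rule eventually_mono) (rule less_imp_le[OF d[rule_format]])
      with tendsto_dist[OF s(2) s'(2)] show "dist y y' \<le> e"
        by (rule tendsto_upperbound) simp
    qed
  qed
  define \<phi> where "\<phi> t = (SOME y. P t y)" for t
  have \<phi>: "P t (\<phi> t)" if "t \<in> closure (range h)" for t
    unfolding \<phi>_def using ex[OF that] by (rule someI_ex)
  show ?thesis
  proof (intro exI[of _ \<phi>] conjI allI)
    show "continuous_on (closure (range h)) \<phi>"
      unfolding continuous_on_iff
    proof (intro ballI allI impI)
      fix t and e :: real assume t: "t \<in> closure (range h)" and "e > 0"
      obtain d where "d > 0"
        and d: "\<forall>t t' y y'. P t y \<and> P t' y' \<and> dist t t' < d \<longrightarrow> dist y y' \<le> e / 2"
        using modulus[OF half_gt_zero[OF \<open>e > 0\<close>]] by (elim exE conjE) (rule that)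
      have "dist (\<phi> t') (\<phi> t) < e" if "t' \<in> closure (range h)" "dist t' t < d" for t'
        using d[rule_format, OF conjI[OF \<phi>[OF that(1)] conjI[OF \<phi>[OF t] that(2)]]] \<open>e > 0\<close>
        by linarith
      with \<open>d > 0\<close> show "\<exists>d>0. \<forall>t'\<in>closure (range h). dist t' t < d \<longrightarrow> dist (\<phi> t') (\<phi> t) < e"
        by (intro exI[of _ d] conjI ballI impI)
    qed
    fix x
    have Px: "P (h x) x"
      unfolding P_def by (rule exI[of _ "\<lambda>_. x"]) simp
    have P\<phi>: "P (h x) (\<phi> (h x))"
      by (rule \<phi>[OF closure_subset[THEN subsetD, OF rangeI]])
    have small: "dist (\<phi> (h x)) x \<le> e" if e: "e > 0" for e
    proof -
      obtain d where "d > 0"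
        and d: "\<forall>t t' y y'. P t y \<and> P t' y' \<and> dist t t' < d \<longrightarrow> dist y y' \<le> e"
        using modulus[OF e] by (elim exE conjE) (rule that)
      then show ?thesis
        using d[rule_format, OF conjI[OF P\<phi> conjI[OF Px]]] by simp
    qed
    have "dist (\<phi> (h x)) x \<le> 0"
      by (rule field_le_epsilon) (simp add: small)
    then show "\<phi> (h x) = x"
      by simp
  qed
qed

lemma integrable_continuous_compact:
  fixes f :: "'b::topological_space \<Rightarrow> real"
  assumes "compact (UNIV :: 'b set)" "finite_measure M" "sets M = sets borel" "continuous_on UNIV f"
  shows "integrable M f"
proof -
  have "compact (range f)"
    using assms by (intro compact_continuous_image)
  then obtain K where K: "\<And>x. norm (f x) \<le> K"
    using compact_imp_bounded[of "range f"] by (auto simp: bounded_iff)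
  show ?thesis
  proof (rule finite_measure.integrable_const_bound[OF assms(2)])
    show "f \<in> borel_measurable M"
      using assms by (simp add: borel_measurable_continuous_onI cong: measurable_cong_sets)
    show "AE x in M. norm (f x) \<le> K"
      using K by simp
  qed
qed

text \<open>Sequential compactness of the probability measures on a compact metric space. The space is
  coded by reals \<open>h\<close> with a uniformly continuous inverse \<open>\<phi>\<close>, so Helly's selection theorem applies
  to the images under \<open>h\<close>, and continuous functions are transported by \<open>\<phi>\<close> and Tietze's theorem.\<close>

theorem compact_weak_subsequence:
  fixes \<mu> :: "nat \<Rightarrow> 'b::metric_space measure"
  assumes cpt: "compact (UNIV :: 'b set)"
    and prob: "\<And>n. prob_space (\<mu> n)" and sets: "\<And>n. sets (\<mu> n) = sets borel"
  shows "\<exists>r \<nu>. strict_mono (r :: nat \<Rightarrow> nat) \<and> prob_space \<nu> \<and> sets \<nu> = sets borel \<and>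
    (\<forall>f :: 'b \<Rightarrow> real. continuous_on UNIV f \<longrightarrow> (\<lambda>n. \<integral>x. f x \<partial>\<mu> (r n)) \<longlonglongrightarrow> (\<integral>x. f x \<partial>\<nu>))"
proof -
  obtain h :: "'b \<Rightarrow> real" where h_meas: "h \<in> borel_measurable borel"
    and h01: "\<forall>x. 0 \<le> h x" "\<forall>x. h x \<le> 1"
    and h_inv: "\<forall>e>0. \<exists>d>0. \<forall>x y. dist (h x) (h y) < d \<longrightarrow> dist x y < e"
    using compact_UNIV_real_coding[OF cpt] by (elim exE conjE) (rule that)
  define K where "K = closure (range h)"
  have "\<exists>\<phi>. continuous_on K \<phi> \<and> (\<forall>x. \<phi> (h x) = x)"
    unfolding K_def by (rule uniformly_continuous_inverse_extends[OF cpt h_inv])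
  then obtain \<phi> where \<phi>': "continuous_on K \<phi> \<and> (\<forall>x. \<phi> (h x) = x)"
    by (rule exE)
  note \<phi> = conjunct1[OF \<phi>'] conjunct2[OF \<phi>', rule_format]
  have hK: "h x \<in> K" for x
    unfolding K_def by (rule closure_subset[THEN subsetD, OF rangeI])
  have [measurable]: "h \<in> borel_measurable (\<mu> n)" for n
    using h_meas sets by (simp cong: measurable_cong_sets)
  define \<mu>' where "\<mu>' n = distr (\<mu> n) borel h" for n
  have rd: "real_distribution (\<mu>' n)" for n
  proof -
    interpret prob_space "\<mu> n" by (rule prob)
    show ?thesis
      unfolding \<mu>'_def by (rule real_distribution_distr) simp
  qed
  have int': "(\<integral>t. g t \<partial>\<mu>' n) = (\<integral>x. g (h x) \<partial>\<mu> n)"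
    if "g \<in> borel_measurable borel" for g :: "real \<Rightarrow> real" and n
    unfolding \<mu>'_def using that by (intro integral_distr) auto
  have "tight \<mu>'"
    unfolding tight_def
  proof (intro conjI allI impI)
    fix e :: real assume "e > 0"
    \<comment> \<open>All codes lie in the unit interval; the left end is -1 because the interval is
      open on the left and must contain 0.\<close>
    have "measure (\<mu>' n) {-1<..1} = 1" for n
    proof -
      interpret prob_space "\<mu> n" by (rule prob)
      have "-1 < h x" for x
        using h01(1)[rule_format, of x] by linarith
      then have h_vimage: "h -` {-1<..1} \<inter> space (\<mu> n) = space (\<mu> n)"
        using h01(2) by auto
      have "measure (\<mu>' n) {-1<..1} = measure (\<mu> n) (h -` {-1<..1} \<inter> space (\<mu> n))"
        unfolding \<mu>'_def by (rule measure_distr) simp_all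
      then show ?thesis
        by (simp only: h_vimage prob_space)
    qed
    then have *: "\<forall>n. 1 - e < measure (\<mu>' n) {-1<..1}"
      using \<open>e > 0\<close> by simp
    show "\<exists>a b. a < b \<and> (\<forall>n. 1 - e < measure (\<mu>' n) {a<..b})"
      by (rule exI[of _ "-1"], rule exI[of _ 1]) (simp add: *)
  qed (rule rd)
  then have "\<exists>r M. strict_mono (r :: nat \<Rightarrow> nat) \<and> real_distribution M \<and> weak_conv_m (\<mu>' \<circ> id \<circ> r) M"
    by (rule tight_imp_convergent_subsubsequence) (simp add: strict_mono_def)
  then obtain r M where r: "strict_mono (r :: nat \<Rightarrow> nat)" and M: "real_distribution M"
    and wc: "weak_conv_m (\<mu>' \<circ> id \<circ> r) M"
    by (elim exE conjE) (rule that)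
  interpret M: real_distribution M by (rule M)
  have conv: "(\<lambda>n. \<integral>x. g (h x) \<partial>\<mu> (r n)) \<longlonglongrightarrow> (\<integral>t. g t \<partial>M)"
    if g: "continuous_on UNIV g" "\<And>t. norm (g t) \<le> C" for g :: "real \<Rightarrow> real" and C
  proof -
    have "g \<in> borel_measurable borel"
      using g(1) by (rule borel_measurable_continuous_onI)
    moreover have "(\<lambda>n. \<integral>t. g t \<partial>(\<mu>' \<circ> id \<circ> r) n) \<longlonglongrightarrow> (\<integral>t. g t \<partial>M)"
    proof (rule weak_conv_imp_integral_bdd_continuous_conv[OF _ M wc])
      show "real_distribution ((\<mu>' \<circ> id \<circ> r) n)" for n
        using rd by simp
      show "isCont g t" for t
        using g(1) by (simp add: continuous_on_eq_continuous_at)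
    qed (rule g(2))
    ultimately show ?thesis
      by (simp add: int')
  qed
  have K_ne: "K \<noteq> {}"
    using hK by blast
  have "closed K"
    by (simp add: K_def)
  have AE_K: "AE t in M. t \<in> K"
  proof -
    \<comment> \<open>A bounded continuous function vanishing exactly on \<open>K\<close>. Its
      integrals along the sequence are 0, so the limit measure is concentrated on
      \<open>K\<close>.\<close>
    define g where "g t = min 1 (infdist t K)" for t
    have g: "continuous_on UNIV g" "\<And>t. norm (g t) \<le> 1"
      unfolding g_def by (auto intro!: continuous_intros simp: infdist_nonneg)
    have "(\<lambda>n. \<integral>x. g (h x) \<partial>\<mu> (r n)) = (\<lambda>_. 0)"
      using hK by (simp add: g_def)
    then have "(\<integral>t. g t \<partial>M) = 0"
      using conv[OF g] by (simp add: LIMSEQ_const_iff)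
    moreover have "integrable M g"
      by (rule M.integrable_const_bound[of _ 1])
        (use g(2) borel_measurable_continuous_onI[OF g(1)] in simp_all)
    ultimately have "AE t in M. g t = 0"
      by (subst (asm) integral_nonneg_eq_0_iff_AE) (auto simp: g_def infdist_nonneg)
    then show ?thesis
      by eventually_elim
        (use in_closed_iff_infdist_zero[OF \<open>closed K\<close> K_ne] in \<open>auto simp: g_def min_def split: if_splits\<close>)
  qed
  \<comment> \<open>Off \<open>K\<close>, a null set for \<open>M\<close>, the decoding map takes a
    constant value to be Borel on the whole line.\<close>
  define \<psi> where "\<psi> t = (if t \<in> K then \<phi> t else undefined)" for t
  have \<psi>_meas: "\<psi> \<in> borel_measurable borel"
    unfolding \<psi>_def using \<open>closed K\<close> \<phi>(1)
    by (intro borel_measurable_continuous_on_if) (auto intro: continuous_on_const)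
  then have \<psi>M: "\<psi> \<in> measurable M borel"
    by simp
  define \<nu> where "\<nu> = distr M borel \<psi>"
  show ?thesis
  proof (rule exI[of _ r], rule exI[of _ \<nu>], intro conjI allI impI)
    show "strict_mono r" by (rule r)
    show "prob_space \<nu>"
      unfolding \<nu>_def using \<psi>M by (rule M.prob_space_distr)
    show "sets \<nu> = sets borel"
      by (simp add: \<nu>_def)
    fix f :: "'b \<Rightarrow> real" assume f: "continuous_on UNIV f"
    have "compact (range f)"
      using cpt f by (intro compact_continuous_image)
    then obtain C where "C > 0" and C: "\<And>x. norm (f x) \<le> C"
      using compact_imp_bounded[of "range f"] by (auto simp: bounded_pos)
    have "continuous_on K (\<lambda>t. f (\<phi> t))"
      by (rule continuous_on_compose2[OF f \<phi>(1)]) simp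
    \<comment> \<open>Weak convergence on the line tests globally continuous bounded functions, so
      \<open>f\<close> composed with the decoding is extended from \<open>K\<close> by Tietze's
      theorem.\<close>
    then obtain g where g: "continuous_on UNIV g" "\<And>t. t \<in> K \<Longrightarrow> g t = f (\<phi> t)"
      "\<And>t. norm (g t) \<le> C"
      using Tietze[of K "\<lambda>t. f (\<phi> t)" UNIV C] \<open>closed K\<close> C \<open>C > 0\<close> by (auto simp: less_imp_le)
    have "(\<integral>x. f x \<partial>\<nu>) = (\<integral>t. f (\<psi> t) \<partial>M)"
      unfolding \<nu>_def using \<psi>M f by (intro integral_distr borel_measurable_continuous_onI)
    also have "\<dots> = (\<integral>t. g t \<partial>M)"
    proof (rule integral_cong_AE)
      show "(\<lambda>t. f (\<psi> t)) \<in> borel_measurable M"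
        using borel_measurable_continuous_onI[OF f] \<psi>M by (rule measurable_compose[rotated])
      show "g \<in> borel_measurable M"
        using borel_measurable_continuous_onI[OF g(1)] by simp
      show "AE t in M. f (\<psi> t) = g t"
        using AE_K by eventually_elim (simp add: \<psi>_def g(2))
    qed
    finally show "(\<lambda>n. \<integral>x. f x \<partial>\<mu> (r n)) \<longlonglongrightarrow> (\<integral>x. f x \<partial>\<nu>)"
      using conv[OF g(1,3)] by (simp add: g(2) hK \<phi>(2))
  qed
qed

text \<open>The indicator of a nonempty closed set is a bounded pointwise limit of continuous
  functions of the distance to it. Closed sets are stable under intersection and generate the Borel
  sets.\<close>

lemma measure_eqI_continuous_integrals:
  fixes M N :: "'b::metric_space measure"
  assumes "finite_measure M" "finite_measure N" and sets: "sets M = sets borel" "sets N = sets borel"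
    and eq: "\<And>f :: 'b \<Rightarrow> real. continuous_on UNIV f \<Longrightarrow> (\<integral>x. f x \<partial>M) = (\<integral>x. f x \<partial>N)"
  shows "M = N"
proof -
  interpret M: finite_measure M by fact
  interpret N: finite_measure N by fact
  have lim: "(\<lambda>n. \<integral>x. max 0 (1 - real n * infdist x F) \<partial>L) \<longlonglongrightarrow> measure L F"
    if F: "closed F" "F \<noteq> {}" and L: "finite_measure L" "sets L = sets borel" for F :: "'b set" and L
  proof -
    interpret L: finite_measure L by fact
    have [measurable]: "F \<in> sets L"
      using F L by simp
    have "(\<lambda>n. \<integral>x. max 0 (1 - real n * infdist x F) \<partial>L) \<longlonglongrightarrow> (\<integral>x. indicator F x \<partial>L)"
    proof (rule integral_dominated_convergence[where w = "\<lambda>_. 1"])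
      show "(\<lambda>x. max 0 (1 - real n * infdist x F)) \<in> borel_measurable L" for n
        using L(2) by (auto intro!: borel_measurable_continuous_onI continuous_intros cong: measurable_cong_sets)
      show "AE x in L. (\<lambda>n. max 0 (1 - real n * infdist x F)) \<longlonglongrightarrow> indicator F x"
      proof (rule AE_I2)
        fix x
        show "(\<lambda>n. max 0 (1 - real n * infdist x F)) \<longlonglongrightarrow> indicator F x"
        proof (cases "x \<in> F")
          case False
          then have "infdist x F > 0"
            using in_closed_iff_infdist_zero[OF F] infdist_nonneg[of x F] by (metis order_le_less)
          then obtain N :: nat where N: "1 < real N * infdist x F"
            using reals_Archimedean3 by blast
          have "max 0 (1 - real n * infdist x F) = 0" if "n \<ge> N" for n
          proof -
            have "real N * infdist x F \<le> real n * infdist x F"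
              using that by (intro mult_right_mono infdist_nonneg) auto
            with N show ?thesis by simp
          qed
          then have "\<forall>\<^sub>F n in sequentially. max 0 (1 - real n * infdist x F) = 0"
            by (rule eventually_sequentiallyI)
          with False show ?thesis
            by (simp add: tendsto_eventually)
        qed simp
      qed
    qed (auto simp: infdist_nonneg)
    then show ?thesis
      using L(2) sets_eq_imp_space_eq[OF L(2)] by (simp add: space_borel)
  qed
  have closed_eq: "emeasure M F = emeasure N F" if "closed F" for F
  \<comment> \<open>The empty set is separate because \<open>infdist x {}\<close> is 0, which would
    make the approximating functions constantly 1.\<close>
  proof (cases "F = {}")
    case False
    have "(\<integral>x. max 0 (1 - real n * infdist x F) \<partial>M) = (\<integral>x. max 0 (1 - real n * infdist x F) \<partial>N)" for n
      by (intro eq continuous_intros)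
    then have "measure M F = measure N F"
      using lim[OF that False assms(1) sets(1)] lim[OF that False assms(2) sets(2)]
        LIMSEQ_unique by simp
    then show ?thesis
      by (simp add: M.emeasure_eq_measure N.emeasure_eq_measure)
  qed simp
  show ?thesis
  proof (rule measure_eqI_generator_eq[where E = "Collect closed" and \<Omega> = UNIV and A = "\<lambda>_. UNIV"])
    show "Int_stable (Collect closed :: 'b set set)"
      by (auto simp: Int_stable_def)
    show "sets M = sigma_sets UNIV (Collect closed)" "sets N = sigma_sets UNIV (Collect closed)"
      by (auto simp: sets borel_eq_closed)
  qed (use closed_eq M.emeasure_finite in auto)
qed

section \<open>Poincare recurrence\<close>

lemma funpow_measurable: "T \<in> measurable M M \<Longrightarrow> (T ^^ n) \<in> measurable M M"
  by (induction n) (auto intro: measurable_comp simp del: funpow.simps simp: funpow_Suc_right funpow_0)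

lemma distr_funpow_invariant:
  assumes "T \<in> measurable M M" "distr M M T = M"
  shows "distr M M (T ^^ n) = M"
proof (induction n)
  case (Suc n)
  have "distr M M (T ^^ Suc n) = distr (distr M M T) M (T ^^ n)"
    using assms(1) funpow_measurable[OF assms(1), of n]
    by (simp add: distr_distr funpow_Suc_right del: funpow.simps)
  also have "\<dots> = M"
    by (simp only: assms(2) Suc)
  finally show ?case .
qed (simp add: distr_id2 id_def)

lemma AE_funpow_invariant:
  assumes T: "T \<in> measurable M M" "distr M M T = M" and P: "AE x in M. P x"
  shows "AE x in M. P ((T ^^ n) x)"
proof -
  have "AE x in distr M M (T ^^ n). P x"
    unfolding distr_funpow_invariant[OF T] by (rule P)
  then show ?thesis
    using funpow_measurable[OF T(1)] by (rule AE_distrD[rotated])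
qed

text \<open>The points of \<open>B\<close> that never return form a set with pairwise disjoint
  preimages of equal measure, hence a null set. If a point of \<open>B\<close> returned only
  finitely often, its last visit would lie in that set.\<close>

theorem poincare_recurrence:
  assumes "finite_measure M" and T: "T \<in> measurable M M" "distr M M T = M" and B: "B \<in> sets M"
  shows "AE x in M. x \<in> B \<longrightarrow> (\<exists>\<^sub>F n in sequentially. (T ^^ n) x \<in> B)"
proof -
  interpret finite_measure M by fact
  note [measurable] = funpow_measurable[OF T(1)] B
  define W where "W = {x \<in> space M. x \<in> B \<and> (\<forall>n. (T ^^ Suc n) x \<notin> B)}"
  have W: "W \<in> sets M"
    unfolding W_def by measurable
  define V where "V n = (T ^^ n) -` W \<inter> space M" for n
  have V: "V n \<in> sets M" for n
    unfolding V_def using funpow_measurable[OF T(1)] W by (rule measurable_sets)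
  have "measure M (V n) = measure (distr M M (T ^^ n)) W" for n
    unfolding V_def using funpow_measurable[OF T(1)] W by (simp add: measure_distr)
  then have VW: "measure M (V n) = measure M W" for n
    by (simp add: distr_funpow_invariant[OF T])
  have "disjoint_family V"
    unfolding disjoint_family_on_def
  proof (intro ballI impI)
    have "V m \<inter> V n = {}" if "m < n" for m n
    proof -
      obtain k where n: "n = Suc k + m"
        using \<open>m < n\<close> less_imp_Suc_add by (metis add.commute add_Suc_right)
      have "(T ^^ n) x = (T ^^ Suc k) ((T ^^ m) x)" for x
        unfolding n by (simp only: funpow_add o_apply)
      then show ?thesis
        by (auto simp: V_def W_def simp del: funpow.simps)
    qed
    then show "V m \<inter> V n = {}" if "m \<noteq> n" for m n
      using that by (metis inf_commute nat_neq_iff)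
  qed
  then have "(\<lambda>n. measure M (V n)) sums measure M (\<Union>n. V n)"
    by (intro finite_measure_UNION) (use V in auto)
  \<comment> \<open>A constant sequence is summable only if it is 0.\<close>
  then have "measure M W = 0"
    by (simp add: VW sums_iff summable_const_iff)
  then have "AE x in M. x \<notin> W"
    by (intro AE_I'[of W]) (auto simp: W emeasure_eq_measure null_sets_def)
  then have "AE x in M. \<forall>n. (T ^^ n) x \<notin> W"
    by (intro AE_all_countable[THEN iffD2] allI AE_funpow_invariant[OF T])
  then show ?thesis
  proof (rule AE_mp, intro AE_I2 impI)
    fix x assume x: "x \<in> space M" "\<forall>n. (T ^^ n) x \<notin> W" "x \<in> B"
    show "\<exists>\<^sub>F n in sequentially. (T ^^ n) x \<in> B"
    proof (rule ccontr)
      assume "\<not> (\<exists>\<^sub>F n in sequentially. (T ^^ n) x \<in> B)"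
      then obtain N where N: "\<And>n. n \<ge> N \<Longrightarrow> (T ^^ n) x \<notin> B"
        unfolding frequently_def eventually_sequentially by auto
      \<comment> \<open>\<open>S\<close> is the set of visit times; its maximum is the last
        visit.\<close>
      define S where "S = {n. (T ^^ n) x \<in> B}"
      have "S \<subseteq> {..<N}"
        using N unfolding S_def by (auto simp: not_le[symmetric])
      then have fin: "finite S"
        by (rule finite_subset) simp
      have "0 \<in> S"
        using x(3) by (simp add: S_def)
      then have "Max S \<in> S"
        using fin by (intro Max_in) auto
      moreover have "(T ^^ Suc k) ((T ^^ Max S) x) \<notin> B" for k
      proof
        assume "(T ^^ Suc k) ((T ^^ Max S) x) \<in> B"
        then have "Suc k + Max S \<in> S"
          unfolding S_def mem_Collect_eq funpow_add o_apply .
        from Max_ge[OF fin this] show False by simp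
      qed
      moreover have "(T ^^ Max S) x \<in> space M"
        using measurable_space[OF funpow_measurable[OF T(1)] x(1)] .
      ultimately have "(T ^^ Max S) x \<in> W"
        by (auto simp: W_def S_def simp del: funpow.simps)
      with x(2) show False by simp
    qed
  qed
qed

section \<open>Weak limits of periodic orbit measures\<close>

lemma continuous_translation: "continuous_on UNIV (translation :: (int \<Rightarrow> 'a::topological_space) \<Rightarrow> _)"
  unfolding translation_def
  by (intro continuous_on_coordinatewise_then_product continuous_coordinate)

lemma translation_funpow: "(translation ^^ n) x = (\<lambda>i. x (i + int n))"
  by (induction n) (auto simp: translation_def ac_simps)

text \<open>Both \<open>f\<close> and its composition with the continuous map \<open>T\<close> are
  admissible test functions, so equality of their integrals passes to the limit.\<close>

lemma weak_limit_invariant: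
  fixes T :: "'b::metric_space \<Rightarrow> 'b"
  assumes T: "continuous_on UNIV T"
    and \<nu>: "prob_space \<nu>" "sets \<nu> = sets borel"
    and conv: "\<And>f :: 'b \<Rightarrow> real. continuous_on UNIV f \<Longrightarrow> (\<lambda>n. \<integral>x. f x \<partial>\<mu> n) \<longlonglongrightarrow> (\<integral>x. f x \<partial>\<nu>)"
    and inv: "\<And>n (f :: 'b \<Rightarrow> real). continuous_on UNIV f \<Longrightarrow> (\<integral>x. f (T x) \<partial>\<mu> n) = (\<integral>x. f x \<partial>\<mu> n)"
  shows "distr \<nu> borel T = \<nu>"
proof (rule measure_eqI_continuous_integrals)
  interpret prob_space \<nu> by fact
  have T_meas: "T \<in> measurable \<nu> borel"
    using borel_measurable_continuous_onI[OF T] \<nu>(2) by (simp cong: measurable_cong_sets)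
  then show "finite_measure (distr \<nu> borel T)"
    by (rule finite_measure_distr)
  fix f :: "'b \<Rightarrow> real" assume f: "continuous_on UNIV f"
  have fT: "continuous_on UNIV (\<lambda>x. f (T x))"
    by (rule continuous_on_compose2[OF f T]) simp
  have "(\<lambda>n. \<integral>x. f x \<partial>\<mu> n) \<longlonglongrightarrow> (\<integral>x. f (T x) \<partial>\<nu>)"
    using conv[OF fT] by (simp add: inv[OF f])
  with conv[OF f] have "(\<integral>x. f (T x) \<partial>\<nu>) = (\<integral>x. f x \<partial>\<nu>)"
    by (rule LIMSEQ_unique[rotated])
  then show "(\<integral>x. f x \<partial>distr \<nu> borel T) = (\<integral>x. f x \<partial>\<nu>)"
    using integral_distr[OF T_meas borel_measurable_continuous_onI[OF f]] by simp
qed (use \<nu> in \<open>auto intro: prob_space.finite_measure\<close>)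

definition orbit_measure :: "('b::topological_space \<Rightarrow> 'b) \<Rightarrow> nat \<Rightarrow> 'b \<Rightarrow> 'b measure" where
  "orbit_measure T n x = distr (measure_pmf (pmf_of_set {..<n})) borel (\<lambda>k. (T ^^ k) x)"

lemma prob_space_orbit_measure: "prob_space (orbit_measure T n x)"
  unfolding orbit_measure_def by (rule measure_pmf.prob_space_distr) simp

lemma integral_orbit_measure:
  fixes f :: "'b::topological_space \<Rightarrow> real"
  assumes "n \<ge> 1" "continuous_on UNIV f"
  shows "(\<integral>y. f y \<partial>orbit_measure T n x) = (\<Sum>k<n. f ((T ^^ k) x)) / n"
proof -
  have "(\<integral>y. f y \<partial>orbit_measure T n x) = (\<integral>k. f ((T ^^ k) x) \<partial>measure_pmf (pmf_of_set {..<n}))"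
    unfolding orbit_measure_def
    by (rule integral_distr) (simp_all add: borel_measurable_continuous_onI[OF assms(2)])
  also have "\<dots> = (\<Sum>k<n. f ((T ^^ k) x)) / card {..<n}"
    by (rule integral_pmf_of_set) (use assms(1) in \<open>auto simp: lessThan_empty_iff\<close>)
  finally show ?thesis by simp
qed

lemma integral_orbit_measure_periodic:
  fixes f :: "'b::topological_space \<Rightarrow> real"
  assumes "n \<ge> 1" "continuous_on UNIV f" "continuous_on UNIV T" "(T ^^ n) x = x"
  shows "(\<integral>y. f (T y) \<partial>orbit_measure T n x) = (\<integral>y. f y \<partial>orbit_measure T n x)"
proof -
  have fT: "continuous_on UNIV (\<lambda>x. f (T x))"
    by (rule continuous_on_compose2[OF assms(2,3)]) simp
  \<comment> \<open>The orbit sums of \<open>f\<close> and of \<open>f\<close> after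
    \<open>T\<close> differ only in the terms at times 0 and \<open>n\<close>, which agree by
    periodicity.\<close>
  have "(\<Sum>k<n. f ((T ^^ k) x)) + f ((T ^^ n) x) = f ((T ^^ 0) x) + (\<Sum>k<n. f ((T ^^ Suc k) x))"
    using sum.lessThan_Suc[of "\<lambda>k. f ((T ^^ k) x)" n]
      sum.lessThan_Suc_shift[of "\<lambda>k. f ((T ^^ k) x)" n] by (rule trans[OF sym])
  then show ?thesis
    using integral_orbit_measure[OF assms(1) fT] integral_orbit_measure[OF assms(1,2)] assms(4)
    by simp
qed

section \<open>Minimizing measures\<close>

context critical_chains
begin

lemma compact_UNIV_sequences: "compact (UNIV :: (int \<Rightarrow> 'a) set)"
  by (rule compact_UNIV_fun[OF compact_UNIV])

lemma continuous_edge: "continuous_on UNIV (\<lambda>x :: int \<Rightarrow> 'a. A (x 0, x 1))"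
  by (intro continuous_intros continuous_on_compose2[OF continuous_A] continuous_coordinate) auto

lemma exists_periodic_sequence:
  fixes p :: 'a
  assumes "n \<ge> 1"
  shows "\<exists>x :: int \<Rightarrow> 'a. (translation ^^ n) x = x \<and>
    (\<Sum>k<n. A (((translation ^^ k) x) 0, ((translation ^^ k) x) 1)) = chain_cost A n (p, p)"
proof -
  obtain z where z: "z 0 = p" "z n = p" "chain_cost A n (p, p) = action z n"
    using chain_cost_Least(1)[OF assms, of p p] by (elim exE conjE) (rule that)
  define x where "x i = z (nat (i mod int n))" for i :: int
  show ?thesis
  proof (rule exI[of _ x], rule conjI)
    show "(translation ^^ n) x = x"
      by (rule ext) (simp add: translation_funpow x_def)
    \<comment> \<open>At \<open>k = n\<close> the index wraps around to 0; the chain is closed, so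
      the value is still \<open>z n\<close>.\<close>
    have x_eq: "x (int k) = z k" if "k \<le> n" for k
      using that z assms by (cases "k = n") (auto simp: x_def)
    have "A (((translation ^^ k) x) 0, ((translation ^^ k) x) 1) = A (z k, z (Suc k))" if "k < n" for k
      using x_eq[of k] x_eq[of "Suc k"] that by (simp add: translation_funpow add.commute)
    then show "(\<Sum>k<n. A (((translation ^^ k) x) 0, ((translation ^^ k) x) 1)) = chain_cost A n (p, p)"
      unfolding z(3) by (intro sum.cong) auto
  qed
qed

lemma exists_invariant_measure_mean_action_0: "\<exists>\<nu>\<in>invariant_measures. mean_action A \<nu> = 0"
proof -
  fix p :: 'a
  have "\<forall>n. \<exists>x :: int \<Rightarrow> 'a. (translation ^^ Suc n) x = x \<and>
      (\<Sum>k<Suc n. A (((translation ^^ k) x) 0, ((translation ^^ k) x) 1)) = chain_cost A (Suc n) (p, p)"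
    by (intro allI exists_periodic_sequence) simp
  from choice[OF this] obtain x :: "nat \<Rightarrow> int \<Rightarrow> 'a"
    where x: "\<forall>n. (translation ^^ Suc n) (x n) = x n \<and>
      (\<Sum>k<Suc n. A (((translation ^^ k) (x n)) 0, ((translation ^^ k) (x n)) 1)) =
      chain_cost A (Suc n) (p, p)"
    by (rule exE)
  note per = x[rule_format, THEN conjunct1] and cost = x[rule_format, THEN conjunct2]
  define \<mu> where "\<mu> n = orbit_measure translation (Suc n) (x n)" for n
  have prob_\<mu>: "prob_space (\<mu> n)" and sets_\<mu>: "sets (\<mu> n) = sets borel" for n
    unfolding \<mu>_def by (simp_all add: prob_space_orbit_measure) (simp add: orbit_measure_def)
  obtain r \<nu> where r: "strict_mono (r :: nat \<Rightarrow> nat)" and \<nu>: "prob_space \<nu>" "sets \<nu> = sets borel"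
    and conv: "\<forall>f :: (int \<Rightarrow> 'a) \<Rightarrow> real. continuous_on UNIV f \<longrightarrow>
      (\<lambda>n. \<integral>y. f y \<partial>\<mu> (r n)) \<longlonglongrightarrow> (\<integral>y. f y \<partial>\<nu>)"
    using compact_weak_subsequence[of \<mu>, OF compact_UNIV_sequences prob_\<mu> sets_\<mu>] by (elim exE conjE) (rule that)
  have "distr \<nu> borel translation = \<nu>"
    by (rule weak_limit_invariant[OF continuous_translation \<nu> conv[rule_format]], assumption)
      (auto simp only: \<mu>_def intro!: integral_orbit_measure_periodic continuous_translation per)
  then have "\<nu> \<in> invariant_measures"
    using \<nu> by (simp add: invariant_measures_def)
  moreover have "mean_action A \<nu> = 0"
  proof -
    obtain C where C: "\<And>n p. n \<ge> 1 \<Longrightarrow> \<bar>chain_cost A n p\<bar> \<le> C"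
      using chain_cost_bounded by blast
    \<comment> \<open>Over a full period the average action is the cost of the closed chain divided
      by its length, and growth rate zero bounds that cost.\<close>
    have mean: "(\<integral>y. A (y 0, y 1) \<partial>\<mu> n) = chain_cost A (Suc n) (p, p) / Suc n" for n
      unfolding \<mu>_def using integral_orbit_measure[OF _ continuous_edge, of "Suc n" translation "x n"]
      by (simp only: cost)
    have "(\<lambda>n. \<integral>y. A (y 0, y 1) \<partial>\<mu> n) \<longlonglongrightarrow> 0"
    proof (rule Lim_null_comparison)
      show "\<forall>\<^sub>F n in sequentially. norm (\<integral>y. A (y 0, y 1) \<partial>\<mu> n) \<le> C * inverse (real (Suc n))"
        unfolding mean using C by (intro always_eventually allI) (simp add: divide_inverse abs_mult mult_right_mono)
      show "(\<lambda>n. C * inverse (real (Suc n))) \<longlonglongrightarrow> 0"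
        using tendsto_mult[OF tendsto_const LIMSEQ_inverse_real_of_nat, of C] by simp
    qed
    from LIMSEQ_subseq_LIMSEQ[OF this r] have "(\<lambda>n. \<integral>y. A (y 0, y 1) \<partial>\<mu> (r n)) \<longlonglongrightarrow> 0"
      by (simp add: o_def)
    with conv[rule_format, OF continuous_edge] show ?thesis
      unfolding mean_action_def by (rule LIMSEQ_unique)
  qed
  ultimately show ?thesis by blast
qed

end

section \<open>Excess of an invariant measure and the calibrated set\<close>

locale invariant_critical_chains = critical_chains A for A :: "'a::metric_space \<times> 'a \<Rightarrow> real" +
  fixes \<nu> :: "(int \<Rightarrow> 'a) measure" and p :: 'a
  assumes invariant: "\<nu> \<in> invariant_measures"
begin

sublocale prob_space \<nu>
  using invariant by (simp add: invariant_measures_def)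

lemma sets_\<nu>: "sets \<nu> = sets borel"
  and distr_translation: "distr \<nu> \<nu> translation = \<nu>"
  using invariant by (auto simp: invariant_measures_def cong: distr_cong)

lemma continuous_imp_measurable: "continuous_on UNIV f \<Longrightarrow> f \<in> measurable \<nu> borel"
  using borel_measurable_continuous_onI sets_\<nu> by (simp cong: measurable_cong_sets)

lemma continuous_imp_integrable: "continuous_on UNIV f \<Longrightarrow> integrable \<nu> (f :: _ \<Rightarrow> real)"
  using compact_UNIV_sequences finite_measure_axioms sets_\<nu> by (rule integrable_continuous_compact)

lemma measurable_translation: "translation \<in> measurable \<nu> \<nu>"
  using continuous_imp_measurable[OF continuous_translation] sets_\<nu> by (simp cong: measurable_cong_sets)

lemma integral_translation:
  assumes "continuous_on UNIV f"
  shows "(\<integral>x. f (translation x) \<partial>\<nu>) = (\<integral>x. (f x :: real) \<partial>\<nu>)"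
proof -
  have "(\<integral>x. f x \<partial>distr \<nu> \<nu> translation) = (\<integral>x. f (translation x) \<partial>\<nu>)"
    by (rule integral_distr[OF measurable_translation continuous_imp_measurable[OF assms]])
  then show ?thesis
    by (simp only: distr_translation)
qed

definition potential :: "'a \<Rightarrow> real" where
  "potential y = barrier (p, y)"

lemma continuous_potential: "continuous_on UNIV potential"
  unfolding potential_def
  by (intro continuous_intros continuous_on_compose2[OF continuous_barrier]) auto

text \<open>The action density corrected by a coboundary: it becomes pointwise nonnegative without
  changing its integral.\<close>

definition excess :: "(int \<Rightarrow> 'a) \<Rightarrow> real" where
  "excess x = A (x 0, x 1) - (potential (x 1) - potential (x 0))"

lemma continuous_excess: "continuous_on UNIV excess"
  unfolding excess_def
  by (intro continuous_intros continuous_edge continuous_on_compose2[OF continuous_potential]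
      continuous_coordinate) auto

lemma excess_nonneg: "0 \<le> excess x"
  using barrier_edge[of p "x 1" "x 0"] by (simp add: excess_def potential_def)

text \<open>The subtracted term is the potential at \<open>x 0\<close> after
  \<open>translation\<close> minus itself, so invariance makes its integral vanish.\<close>

lemma mean_action_eq_excess: "mean_action A \<nu> = (\<integral>x. excess x \<partial>\<nu>)"
proof -
  have cont: "continuous_on UNIV (\<lambda>x :: int \<Rightarrow> 'a. potential (x i))" for i
    by (rule continuous_on_compose2[OF continuous_potential continuous_coordinate]) simp
  have "(\<integral>x. potential (x 1) \<partial>\<nu>) = (\<integral>x. potential (x 0) \<partial>\<nu>)"
    using integral_translation[OF cont[of 0]] by (simp add: translation_def)
  then show ?thesis
    unfolding mean_action_def excess_def
    using continuous_imp_integrable[OF cont[of 0]] continuous_imp_integrable[OF cont[of 1]]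
      continuous_imp_integrable[OF continuous_edge] by simp
qed

lemma mean_action_nonneg: "0 \<le> mean_action A \<nu>"
  unfolding mean_action_eq_excess by (intro integral_nonneg_AE AE_I2 excess_nonneg)

lemma mean_action_eq_0_iff: "mean_action A \<nu> = 0 \<longleftrightarrow> (AE x in \<nu>. excess x = 0)"
  unfolding mean_action_eq_excess
  by (rule integral_nonneg_eq_0_iff_AE[OF continuous_imp_integrable[OF continuous_excess]])
    (simp add: excess_nonneg)

text \<open>The triangle inequality through \<open>x 1\<close> gives
  \<open>potential (x 0) <= potential (x 1) + barrier (x 1, x 0)\<close>, and on the calibrated set
  the last term is \<open>- A (x 0, x 1)\<close>. Hence the excess is also nonpositive.\<close>

lemma calibrated_imp_excess_0:
  assumes "(x 0, x 1) \<in> calibrated_set A"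
  shows "excess x = 0"
  using assms excess_nonneg[of x] barrier_triangle[of p "x 0" "x 1"]
  by (simp add: calibrated_set_eq excess_def potential_def)

text \<open>Along a sequence without excess the cost of a chain telescopes to a difference of potentials,
  and a return close to \<open>x 0\<close> turns it into a nearly optimal chain from \<open>x 1\<close> to \<open>x 0\<close>.\<close>

lemma recurrent_imp_calibrated:
  assumes zero: "\<And>n. excess ((translation ^^ n) x) = 0"
    and recurrent: "\<And>d. d > 0 \<Longrightarrow> \<exists>\<^sub>F n in sequentially. dist (x 0) (x (int n)) < d"
  shows "(x 0, x 1) \<in> calibrated_set A"
proof -
  have "barrier (x 1, x 0) \<le> potential (x 0) - potential (x 1) + e" if e: "e > 0" for e
  proof -
    obtain d1 where "d1 > 0" and d1: "\<forall>n\<ge>2. \<forall>p q. dist p q < d1 \<longrightarrow>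
        \<bar>chain_cost A n p - chain_cost A n q\<bar> \<le> e / 2"
      using chain_cost_equicontinuous[OF half_gt_zero[OF e]] by (elim exE conjE) (rule that)
    obtain d2 where "d2 > 0" and d2: "\<forall>y. dist y (x 0) < d2 \<longrightarrow> dist (potential y) (potential (x 0)) < e / 2"
      using continuous_potential half_gt_zero[OF e] unfolding continuous_on_iff by blast
    have step: "A (x (int (Suc n)), x (int (Suc (Suc n)))) = potential (x (int (Suc (Suc n)))) - potential (x (int (Suc n)))" for n
      using zero[of "Suc n", unfolded excess_def translation_funpow] by (simp add: add.commute)
    \<comment> \<open>The chain starts at \<open>x 1\<close>, so after \<open>n\<close> edges it
      ends at index \<open>n + 1\<close>.\<close>
    have "action (\<lambda>i. x (int (Suc i))) n = potential (x (int (Suc n))) - potential (x 1)" for n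
      by (subst step, subst sum_lessThan_telescope) simp
    then have chain: "chain_cost A n (x 1, x (int (Suc n))) \<le> potential (x (int (Suc n))) - potential (x 1)"
      if "n \<ge> 1" for n
      using chain_cost_le_action[OF that, of "\<lambda>i. x (int (Suc i))"] by simp
    show ?thesis
    proof (rule barrier_le, unfold frequently_sequentially, rule allI)
      fix N
      have "\<exists>\<^sub>F n in sequentially. dist (x 0) (x (int n)) < min d1 d2"
        by (rule recurrent) (simp add: \<open>d1 > 0\<close> \<open>d2 > 0\<close>)
      \<comment> \<open>A return at time \<open>n\<close> gives a chain of length
        \<open>m = n - 1\<close>, which must be at least \<open>N\<close> and at least 2 for
        equicontinuity.\<close>
      then obtain n where "n \<ge> N + 3" and near: "dist (x 0) (x (int n)) < min d1 d2"
        unfolding frequently_sequentially by blast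
      then obtain m where m: "n = Suc m" "m \<ge> 2" "m \<ge> N"
        by (cases n) auto
      have "\<bar>chain_cost A m (x 1, x 0) - chain_cost A m (x 1, x (int n))\<bar> \<le> e / 2"
        using near by (intro d1[rule_format, OF m(2)]) (simp add: dist_Pair_Pair)
      moreover have "\<bar>potential (x (int n)) - potential (x 0)\<bar> < e / 2"
        using d2[rule_format, of "x (int n)"] near
        by (simp add: dist_commute[of "x (int n)"] flip: dist_real_def)
      moreover have "chain_cost A m (x 1, x (int n)) \<le> potential (x (int n)) - potential (x 1)"
        using chain[of m] m by simp
      ultimately have "chain_cost A m (x 1, x 0) \<le> potential (x 0) - potential (x 1) + e"
        by linarith
      with m(3) show "\<exists>n\<ge>N. chain_cost A n (x 1, x 0) \<le> potential (x 0) - potential (x 1) + e"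
        by blast
    qed
  qed
  then have "barrier (x 1, x 0) \<le> potential (x 0) - potential (x 1)"
    by (rule field_le_epsilon)
  moreover have "A (x 0, x 1) = potential (x 1) - potential (x 0)"
    using zero[of 0] by (simp add: excess_def)
  ultimately show ?thesis
    using calibrated_nonneg[of "x 0" "x 1"] by (simp add: calibrated_set_eq)
qed

text \<open>Recurrence is applied to the cylinders over the countably many sets \<open>B j\<close>,
  so a single null set suffices for every \<open>d\<close>: some \<open>B j\<close> contains
  \<open>x 0\<close> and lies within distance \<open>d\<close> of it.\<close>

lemma AE_recurrent: "AE x in \<nu>. \<forall>d>0. \<exists>\<^sub>F n in sequentially. dist (x 0) (x (int n)) < d"
proof -
  obtain B :: "nat \<Rightarrow> 'a set" where opn: "\<forall>j. open (B j)"
    and B: "\<forall>e>0. \<exists>J. \<forall>x. \<exists>j<J. x \<in> B j \<and> (\<forall>y\<in>B j. dist x y < e)"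
    using compact_UNIV_separating_sequence[OF compact_UNIV] by (elim exE conjE) (rule that)
  have "AE x in \<nu>. \<forall>j. x \<in> (\<lambda>x. x 0) -` B j \<longrightarrow>
      (\<exists>\<^sub>F n in sequentially. (translation ^^ n) x \<in> (\<lambda>x. x 0) -` B j)"
  proof (intro AE_all_countable[THEN iffD2] allI poincare_recurrence)
    have "open ((\<lambda>x :: int \<Rightarrow> 'a. x 0) -` B j)" for j
      by (rule open_vimage[OF opn[rule_format] continuous_coordinate])
    then show "(\<lambda>x. x 0) -` B j \<in> sets \<nu>" for j
      by (simp add: sets_\<nu>)
  qed (fact finite_measure_axioms measurable_translation distr_translation)+
  then show ?thesis
  proof (rule AE_mp, intro AE_I2 impI allI)
    fix x and d :: real
    assume rec: "\<forall>j. x \<in> (\<lambda>x. x 0) -` B j \<longrightarrow>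
        (\<exists>\<^sub>F n in sequentially. (translation ^^ n) x \<in> (\<lambda>x. x 0) -` B j)" and "d > 0"
    obtain j where j: "x 0 \<in> B j" "\<forall>y\<in>B j. dist (x 0) y < d"
      using B[rule_format, OF \<open>d > 0\<close>] by blast
    then have "\<exists>\<^sub>F n in sequentially. x (int n) \<in> B j"
      using rec by (simp add: translation_funpow)
    then show "\<exists>\<^sub>F n in sequentially. dist (x 0) (x (int n)) < d"
      by (rule frequently_elim1) (use j in blast)
  qed
qed

lemma mean_action_eq_0_iff_calibrated:
  "mean_action A \<nu> = 0 \<longleftrightarrow> (AE x in \<nu>. (x 0, x 1) \<in> calibrated_set A)"
proof
  assume "mean_action A \<nu> = 0"
  then have "AE x in \<nu>. excess x = 0"
    by (simp add: mean_action_eq_0_iff)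
  \<comment> \<open>Invariance carries the almost sure equality to every forward iterate, and
    countably many null sets are discarded.\<close>
  then have "AE x in \<nu>. \<forall>n. excess ((translation ^^ n) x) = 0"
    by (intro AE_all_countable[THEN iffD2] allI
        AE_funpow_invariant[OF measurable_translation distr_translation])
  with AE_recurrent show "AE x in \<nu>. (x 0, x 1) \<in> calibrated_set A"
    by eventually_elim (rule recurrent_imp_calibrated, auto)
next
  assume "AE x in \<nu>. (x 0, x 1) \<in> calibrated_set A"
  then show "mean_action A \<nu> = 0"
    unfolding mean_action_eq_0_iff by eventually_elim (rule calibrated_imp_excess_0)
qed

lemma marginal_calibrated_iff:
  "measure (marginal \<nu>) (calibrated_set A) = 1 \<longleftrightarrow> (AE x in \<nu>. (x 0, x 1) \<in> calibrated_set A)"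
proof -
  have pair: "(\<lambda>x :: int \<Rightarrow> 'a. (x 0, x 1)) \<in> measurable \<nu> borel"
    by (intro continuous_imp_measurable continuous_on_Pair continuous_coordinate)
  have "calibrated_set A \<in> sets borel"
    using closed_calibrated_set by (rule borel_closed)
  note meas = measurable_sets[OF pair this]
  have "measure (marginal \<nu>) (calibrated_set A) =
      prob ((\<lambda>x. (x 0, x 1)) -` calibrated_set A \<inter> space \<nu>)"
    unfolding marginal_def using pair \<open>calibrated_set A \<in> sets borel\<close> by (rule measure_distr)
  also have "\<dots> = 1 \<longleftrightarrow> (AE x in \<nu>. (x 0, x 1) \<in> calibrated_set A)"
    unfolding prob_eq_1[OF meas] by (rule AE_cong) simp
  finally show ?thesis .
qed

end

theorem theorem15:
  fixes A :: "'a::metric_space \<times> 'a \<Rightarrow> real"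
  assumes "compact (UNIV :: 'a set)"
    and "connected (UNIV :: 'a set)"
    and "continuous_on UNIV A"
    and "growth_rate A = 0"
  shows "((\<exists>\<nu>\<in>invariant_measures. mean_action A \<nu> = 0) \<and>
          (\<forall>\<nu>\<in>invariant_measures. 0 \<le> mean_action A \<nu>)) \<and>
         (\<forall>\<nu>\<in>invariant_measures.
            minimizing A \<nu> \<longleftrightarrow> measure (marginal \<nu>) (calibrated_set A) = 1)"
proof -
  interpret critical_chains A
    by unfold_locales (fact assms)+
  note ex = exists_invariant_measure_mean_action_0
  have chains: "invariant_critical_chains A \<nu>" if "\<nu> \<in> invariant_measures" for \<nu>
    by unfold_locales (fact that)
  have nonneg: "0 \<le> mean_action A \<nu>" if "\<nu> \<in> invariant_measures" for \<nu>
    using that by (rule invariant_critical_chains.mean_action_nonneg[OF chains])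
  \<comment> \<open>The value 0 is both attained and a lower bound, so minimizing means having mean
    action 0.\<close>
  have "minimizing A \<nu> \<longleftrightarrow> mean_action A \<nu> = 0" if "\<nu> \<in> invariant_measures" for \<nu>
    using ex nonneg that unfolding minimizing_def is_arg_min_def by (metis order_le_less not_less)
  with ex nonneg show ?thesis
    using invariant_critical_chains.mean_action_eq_0_iff_calibrated[OF chains]
      invariant_critical_chains.marginal_calibrated_iff[OF chains] by simp
qed

end
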